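(* Let $R$ be a potential domain, $n\ge1$, and let $s$ be a non-zero $n$-dimensional sequence over $R$ indexed by $-\mathbb{N}^n$. For all $i\in\{1,\dots,n\}$ let $f_i\in\mathrm{Ann}(s)\cap R[X_i]$ with $\deg f_i\ge1$. Put $f=\prod_{i=1}^nf_i$ and $d_i=\gcd\big(f_i,\beta_0(f,s)/X_i\big)$ (a greatest common divisor in $R[X_1,\dots,X_n]$). Then for every $i\in\{1,\dots,n\}$ there is a unit $u_i$ of $R$ such that $u_if_i/d_i$ is the monic generator of the ideal $\mathrm{Ann}(s)\cap R[X_i]$ of $R[X_i]$.
   Context: A factorial domain (unique factorization domain) $R$ is called potential if for all $n\ge1$ the power series ring $S_n=R[[X_1^{-1},\dots,X_n^{-1}]]$ is factorial. $\mathbb{N}=\{0,1,2,\dots\}$. $P_n=R[X_1,\dots,X_n]$; $L_n=R((X_1^{-1},\dots,X_n^{-1}))$ is the ring of Laurent series in $X_1^{-1},\dots,X_n^{-1}$, i.e. formal sums $\sum_{a\in\mathbb{Z}^n}G_aX^a$ whose support is contained in $\{a:a\le d\}$ for some $d\in\mathbb{Z}^n$ (componentwise order), where $X^a=X_1^{a_1}\cdots X_n^{a_n}$. It contains $P_n$ and $S_n$. An $n$-dimensional sequence is a function $s:-\mathbb{N}^n\to R$, $a\mapsto s_a$. $P_n$ acts by right shifting: $(f\circ s)_b=\sum_af_as_{b-a}$ for $f=\sum_af_aX^a\in P_n$, $b\le\mathbf 0$. $\mathrm{Ann}(s)=\{f\in P_n:f\circ s=0\}$, and $\Gamma(s)=\sum_{a\le\mathbf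 0}s_aX^a\in S_n$. For $f\in P_n$, $\delta f$ is the vector of partial degrees of $f$. If $\delta f\ge\mathbf 1=(1,\dots,1)$, the border polynomial is $\beta_0(f,s)=\sum_{\mathbf 1\le a\le\delta f}(f\cdot\Gamma(s))_aX^a\in P_n$; it is divisible by $X_1\cdots X_n$. (For $R$ potential and $f_i$ as in the claim, the ideal $\mathrm{Ann}(s)\cap R[X_i]$ is principal with a unique monic generator.) *)

theory Defs
  imports "HOL-Algebra.Algebra" "HOL-Algebra.Algebraic_Closure_Type" "HOL-Library.Function_Algebras"
begin

text \<open>The coefficient domain R is a type of class \<^class>\<open>idom\<close>.  A point of Z^n is a function
  \<^typ>\<open>nat \<Rightarrow> int\<close> that vanishes outside \<open>{1..n}\<close>; sums, differences, 0 and \<open>\<le>\<close> of such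
  functions are componentwise.  A formal sum of terms G_a X^a is the function taking a to G_a.\<close>

definition exponents :: "nat \<Rightarrow> (nat \<Rightarrow> int) set" where
  "exponents n = {a. \<forall>j. j \<notin> {1..n} \<longrightarrow> a j = 0}"

definition neg_exponents :: "nat \<Rightarrow> (nat \<Rightarrow> int) set" where
  "neg_exponents n = {a \<in> exponents n. a \<le> 0}"

definition supp :: "((nat \<Rightarrow> int) \<Rightarrow> 'a::zero) \<Rightarrow> (nat \<Rightarrow> int) set" where
  "supp F = {a. F a \<noteq> 0}"

text \<open>The ring L_n of Laurent series in the inverses of X_1, ..., X_n.  As supports are bounded
  above, the sum in the product has only finitely many terms.\<close>

definition laurent_ring :: "nat \<Rightarrow> ((nat \<Rightarrow> int) \<Rightarrow> 'a::idom) ring" where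
  "laurent_ring n = \<lparr>
     carrier = {F. supp F \<subseteq> exponents n \<and> (\<exists>d. \<forall>a\<in>supp F. a \<le> d)},
     monoid.mult = (\<lambda>F G a. \<Sum>b | b \<in> supp F \<and> a - b \<in> supp G. F b * G (a - b)),
     one = (\<lambda>a. if a = 0 then 1 else 0),
     ring.zero = 0,
     add = (+)\<rparr>"

definition mpoly_ring :: "nat \<Rightarrow> ((nat \<Rightarrow> int) \<Rightarrow> 'a::idom) ring" where
  "mpoly_ring n = (laurent_ring n)\<lparr>carrier :=
     {F \<in> carrier (laurent_ring n). finite (supp F) \<and> (\<forall>a\<in>supp F. 0 \<le> a)}\<rparr>"

definition power_series_ring :: "nat \<Rightarrow> ((nat \<Rightarrow> int) \<Rightarrow> 'a::idom) ring" where
  "power_series_ring n = (laurent_ring n)\<lparr>carrier :=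
     {F \<in> carrier (laurent_ring n). \<forall>a\<in>supp F. a \<le> 0}\<rparr>"

text \<open>R[X_i], as a subring of R[X_1, ..., X_n].\<close>

definition univ_poly_ring :: "nat \<Rightarrow> nat \<Rightarrow> ((nat \<Rightarrow> int) \<Rightarrow> 'a::idom) ring" where
  "univ_poly_ring n i = (mpoly_ring n)\<lparr>carrier :=
     {F \<in> carrier (mpoly_ring n). \<forall>a\<in>supp F. \<forall>j. j \<noteq> i \<longrightarrow> a j = 0}\<rparr>"

definition potential :: "'a::idom itself \<Rightarrow> bool" where
  "potential _ \<longleftrightarrow>
     factorial_domain (ring_of_type_algebra :: 'a ring) \<and>
     (\<forall>n\<ge>1. factorial_domain (power_series_ring n :: ((nat \<Rightarrow> int) \<Rightarrow> 'a) ring))"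

definition indet :: "nat \<Rightarrow> (nat \<Rightarrow> int) \<Rightarrow> 'a::idom" where
  "indet i = (\<lambda>a. if a = (\<lambda>j. if j = i then 1 else 0) then 1 else 0)"

definition scale :: "'a::idom \<Rightarrow> ((nat \<Rightarrow> int) \<Rightarrow> 'a) \<Rightarrow> (nat \<Rightarrow> int) \<Rightarrow> 'a" where
  "scale c F = (\<lambda>a. c * F a)"

text \<open>The exact quotient of a by b; well defined in a domain when b is non-zero and divides a.\<close>

definition exact_quot :: "('a, 'b) ring_scheme \<Rightarrow> 'a \<Rightarrow> 'a \<Rightarrow> 'a" where
  "exact_quot R a b = (THE c. c \<in> carrier R \<and> a = b \<otimes>\<^bsub>R\<^esub> c)"

text \<open>The degree of a polynomial in X_i, that is, the i-th component of its vector of partial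
  degrees.  Inserting 0 only serves to give the zero polynomial degree 0.\<close>

definition partial_degree :: "((nat \<Rightarrow> int) \<Rightarrow> 'a::idom) \<Rightarrow> nat \<Rightarrow> int" where
  "partial_degree f i = Max (insert 0 ((\<lambda>a. a i) ` supp f))"

text \<open>A sequence is represented by any function on \<^typ>\<open>nat \<Rightarrow> int\<close>; only its values on
  \<^const>\<open>neg_exponents\<close> matter.\<close>

definition shift :: "((nat \<Rightarrow> int) \<Rightarrow> 'a::idom) \<Rightarrow> ((nat \<Rightarrow> int) \<Rightarrow> 'a) \<Rightarrow> (nat \<Rightarrow> int) \<Rightarrow> 'a" where
  "shift f s b = (\<Sum>a\<in>supp f. f a * s (b - a))"

definition Ann :: "nat \<Rightarrow> ((nat \<Rightarrow> int) \<Rightarrow> 'a::idom) \<Rightarrow> ((nat \<Rightarrow> int) \<Rightarrow> 'a) set" where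
  "Ann n s = {f \<in> carrier (mpoly_ring n). \<forall>b\<in>neg_exponents n. shift f s b = 0}"

definition gen_series :: "nat \<Rightarrow> ((nat \<Rightarrow> int) \<Rightarrow> 'a::idom) \<Rightarrow> (nat \<Rightarrow> int) \<Rightarrow> 'a" where
  "gen_series n s = (\<lambda>a. if a \<in> neg_exponents n then s a else 0)"

definition border_poly ::
  "nat \<Rightarrow> ((nat \<Rightarrow> int) \<Rightarrow> 'a::idom) \<Rightarrow> ((nat \<Rightarrow> int) \<Rightarrow> 'a) \<Rightarrow> (nat \<Rightarrow> int) \<Rightarrow> 'a" where
  "border_poly n f s = (\<lambda>a.
     if a \<in> exponents n \<and> (\<forall>j\<in>{1..n}. 1 \<le> a j \<and> a j \<le> partial_degree f j)
     then (f \<otimes>\<^bsub>laurent_ring n\<^esub> gen_series n s) a else 0)"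

definition monic_in :: "nat \<Rightarrow> ((nat \<Rightarrow> int) \<Rightarrow> 'a::idom) \<Rightarrow> bool" where
  "monic_in i g \<longleftrightarrow> g (\<lambda>j. if j = i then partial_degree g i else 0) = 1"

definition monic_generator ::
  "nat \<Rightarrow> nat \<Rightarrow> ((nat \<Rightarrow> int) \<Rightarrow> 'a::idom) \<Rightarrow> ((nat \<Rightarrow> int) \<Rightarrow> 'a) set \<Rightarrow> bool" where
  "monic_generator n i g I \<longleftrightarrow>
     g \<in> carrier (univ_poly_ring n i) \<and> monic_in i g \<and> I = PIdl\<^bsub>univ_poly_ring n i\<^esub> g"

end

theory Submission
  imports Defs "HOL-Computational_Algebra.Formal_Laurent_Series"
begin

text \<open>
  Write \<open>\<Gamma>\<close> for \<open>\<Gamma>(s)\<close>.  A polynomial \<open>h \<in> R[X\<^sub>i]\<close> annihilates \<open>s\<close> exactly when every exponent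
  of \<open>h \<cdot> \<Gamma>\<close> has a positive i-th component (\<open>univ_Ann_iff\<close>).  Hence a product of annihilators, one for
  each variable, turns \<open>\<Gamma>\<close> into a series with positive exponents only; these are bounded above as
  well, so the series is a polynomial divisible by every variable
  (\<open>finprod_Ann_exponents_pos\<close>, \<open>div_indet_in_mpoly\<close>).  In particular \<open>f \<cdot> \<Gamma>\<close> is the border
  polynomial.

  The arithmetic content is that the annihilator in \<open>R[X\<^sub>i]\<close> has a monic generator \<open>\<eta>\<close>
  (\<open>annihilator_monic_generator\<close>).  This is a one-dimensional fact about the family of sequences
  that \<open>s\<close> induces on the lines parallel to the i-th axis.  Among the annihilators of least degree,
  choose \<open>g\<close> whose leading coefficient has the fewest prime factors; then no prime of \<open>R\<close> divides
  \<open>g\<close>.  Let \<open>J\<close> be the ideal of the polynomials divisible by \<open>g\<close> in the ring of Laurent series in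
  the inverse variable; it contains \<open>g\<close> and, up to the variable, all products of \<open>g\<close> with the
  generating series.  An element of \<open>J\<close> of least degree divides all of these up to constants, so
  dividing \<open>g\<close> by it leaves an annihilator; by minimality of the degree of \<open>g\<close>, that element is a
  constant \<open>r\<close>.  So \<open>g\<close>, read backwards as a power series, divides \<open>r\<close>.  Primes of \<open>R\<close> stay prime
  in the power series ring, and none of them divides \<open>g\<close>; cancelling the prime factors of \<open>r\<close>
  one by one shows that \<open>g\<close> is a unit there, i.e. that its leading coefficient is a unit of \<open>R\<close>.

  It remains to compare \<open>\<eta>\<close> with \<open>f\<^sub>i/d\<^sub>i\<close>.  Let \<open>B = \<beta>\<^sub>0(f,s)/X\<^sub>i\<close> and \<open>f\<^sub>i = \<eta>\<epsilon>\<close>.  Replacing the factor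
  \<open>f\<^sub>i\<close> of \<open>f\<close> by \<open>\<eta>\<close> still yields a product of annihilators, so \<open>\<epsilon>\<close> divides \<open>B\<close>; hence \<open>\<epsilon>\<close> is a
  common divisor and divides \<open>d\<^sub>i\<close>.  Conversely, if \<open>f\<^sub>i = d\<^sub>i\<cdot>c\<close> and \<open>B = d\<^sub>i\<cdot>b\<close>, then \<open>c\<cdot>B = f\<^sub>i\<cdot>b\<close>; cancelling
  \<open>f\<^sub>i\<close> shows that \<open>c \<cdot> \<Gamma>\<close>, multiplied by the product of the \<open>f\<^sub>k\<close> with \<open>k \<noteq> i\<close>, is divisible by
  \<open>X\<^sub>i\<close>.  That product does not involve \<open>X\<^sub>i\<close>, so \<open>c\<close> itself annihilates \<open>s\<close> and \<open>\<eta>\<close> divides \<open>c\<close>.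
  The two divisibilities make \<open>c\<close> and \<open>\<eta>\<close> associated.
\<close>

unbundle fps_syntax

section \<open>Prime factorizations in a factorial domain\<close>

text \<open>The number of prime factors, as a relation: it gives the leading coefficients of annihilators a
  measure that drops when a common prime factor of all coefficients is divided out.\<close>

inductive prime_count :: "nat \<Rightarrow> 'a::idom \<Rightarrow> bool" where
  unit: "u dvd 1 \<Longrightarrow> prime_count 0 u"
| step: "prime_elem p \<Longrightarrow> prime_count k r \<Longrightarrow> prime_count (Suc k) (p * r)"

lemma prime_count_unit_mult:
  assumes "prime_count k r" "u dvd 1"
  shows "prime_count k (u * r)"
  using assms
proof (induction rule: prime_count.induct)
  case (unit v)
  then show ?case using mult_dvd_mono[of u 1 v 1] by (auto intro: prime_count.unit)
next
  case (step p k r)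
  then have "prime_count (Suc k) (p * (u * r))"
    by (blast intro: prime_count.step)
  then show ?case by (simp add: mult_ac)
qed

text \<open>The prime \<open>q\<close> divides one of the prime factors of \<open>y\<close> and is then associated to it, so the two
  cancel up to a unit.\<close>

lemma prime_count_cancel_prime:
  assumes "prime_count k y" "prime_elem q" "y = q * x"
  shows "\<exists>k'<k. prime_count k' x"
  using assms
proof (induction arbitrary: x rule: prime_count.induct)
  case (unit u)
  then show ?case
    by (metis dvd_mult_left prime_elem_not_unit)
next
  case (step p k r)
  have q: "q \<noteq> 0" "p \<noteq> 0" using step by auto
  have "q dvd p * r" using step.prems by simp
  then consider "q dvd p" | "q dvd r" using step.prems(1) by (auto simp: prime_elem_dvd_mult_iff)
  then show ?case
  proof cases
    case 1
    then obtain e where e: "p = q * e" by auto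
    have "p dvd q * e" using e by simp
    then have "p dvd q \<or> p dvd e" using step.hyps(1) by (simp add: prime_elem_dvd_mult_iff)
    moreover have "\<not> p dvd e"
    proof
      assume "p dvd e"
      then obtain f where "e = p * f" by auto
      then have "q * f = 1" using e q by (metis mult.assoc mult.commute mult_cancel_left2)
      then show False using step.prems(1) prime_elem_not_unit by (metis dvd_triv_left)
    qed
    ultimately obtain f where "q = p * f" by auto
    then have "f * e = 1" using e q by (metis mult.assoc mult_cancel_left2)
    then have "e dvd 1" by (metis dvd_triv_right)
    moreover have "x = e * r" using step.prems(2) e q by simp
    ultimately show ?thesis using prime_count_unit_mult step.hyps(2) by blast
  next
    case 2
    then obtain r2 where r2: "r = q * r2" by auto
    obtain k' where k': "k' < k" "prime_count k' r2"
      using step.IH[OF step.prems(1) r2] by blast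
    have "q * x = q * (p * r2)" using step.prems(2) r2 by (metis mult.left_commute)
    then have "x = p * r2" using q by simp
    then show ?thesis using k' prime_count.step[OF step.hyps(1)] by blast
  qed
qed

text \<open>The definition of \<^const>\<open>factorial_domain\<close> speaks of irreducible factors; in a factorial monoid they
  are prime.\<close>

lemma factorial_domain_prime_count:
  assumes "factorial_domain (ring_of_type_algebra :: 'a::idom ring)" and "(r::'a) \<noteq> 0"
  shows "\<exists>k. prime_count k r"
proof -
  let ?R = "ring_of_type_algebra :: 'a ring"
  interpret R: factorial_domain ?R by fact
  have car [simp]: "carrier ?R = UNIV" and mult [simp]: "monoid.mult ?R = (*)"
    and one [simp]: "one ?R = 1" and zero [simp]: "ring.zero ?R = 0"
    by (simp_all add: ring_of_type_algebra_def)
  have un: "u \<in> Units ?R \<longleftrightarrow> u dvd 1" for u :: 'a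
    by (auto simp: Units_def dvd_def mult.commute)
  have prime: "prime_elem p" if p: "p \<noteq> 0" "Divisibility.irreducible (mult_of ?R) p" for p :: 'a
  proof -
    have pr: "Divisibility.prime (mult_of ?R) p"
      using R.irreducible_prime[of p] p by simp
    then have "Divisibility.prime ?R p"
      using R.prime_eq_prime_mult[of p] p by auto
    then show ?thesis
      using p(1) un unfolding Divisibility.prime_def prime_elem_def
      by (auto simp: factor_def dvd_def)
  qed
  have list: "\<exists>k. prime_count k (foldr (*) fs 1)"
    if "\<forall>x\<in>set fs. x \<noteq> 0 \<and> Divisibility.irreducible (mult_of ?R) x" for fs :: "'a list"
    using that
  proof (induction fs)
    case Nil
    have "prime_count 0 (1::'a)" by (rule prime_count.unit) simp
    then show ?case by auto
  next
    case (Cons p fs)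
    then show ?case by (auto intro: prime_count.step prime)
  qed
  obtain fs where fs: "set fs \<subseteq> carrier (mult_of ?R)" "wfactors (mult_of ?R) fs r"
    using R.wfactors_exist[of r] assms(2) by auto
  then obtain k where "prime_count k (foldr (*) fs 1)"
    using list[of fs] by (auto simp: wfactors_def)
  moreover from fs have as: "foldr (*) fs 1 \<sim>\<^bsub>mult_of ?R\<^esub> r"
    by (simp add: wfactors_def)
  then obtain u v where "r = foldr (*) fs 1 * u" "foldr (*) fs 1 = r * v"
    unfolding associated_def factor_def mult_mult_of mult by blast
  then have "r * (u * v) = r * 1" "r = u * foldr (*) fs 1" by (simp_all add: mult_ac)
  then have "u dvd 1" "r = u * foldr (*) fs 1"
    using assms(2) by (metis mult_left_cancel dvd_triv_left, blast)
  ultimately show ?thesis using prime_count_unit_mult by metis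
qed

section \<open>Primes of the coefficient ring in the power series ring\<close>

text \<open>Constant primes stay prime among power series: if both factors had a coefficient outside the ideal
  of \<open>p\<close>, the first such coefficients would contribute the only summand not divisible by \<open>p\<close> to a
  coefficient of the product.\<close>

lemma prime_const_dvd_fps_mult:
  fixes G u :: "'a::idom fps"
  assumes p: "prime_elem p" and dvd: "\<And>k. p dvd (G * u) $ k"
  shows "(\<forall>k. p dvd G $ k) \<or> (\<forall>k. p dvd u $ k)"
proof (rule ccontr)
  assume "\<not> ?thesis"
  then obtain i0 j0 where "\<not> p dvd G $ i0" "\<not> p dvd u $ j0" by auto
  define i where "i = (LEAST i. \<not> p dvd G $ i)"
  define j where "j = (LEAST j. \<not> p dvd u $ j)"
  have i: "\<not> p dvd G $ i" "\<And>i'. i' < i \<Longrightarrow> p dvd G $ i'"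
    unfolding i_def using \<open>\<not> p dvd G $ i0\<close> by (rule LeastI) (use not_less_Least in blast)
  have j: "\<not> p dvd u $ j" "\<And>j'. j' < j \<Longrightarrow> p dvd u $ j'"
    unfolding j_def using \<open>\<not> p dvd u $ j0\<close> by (rule LeastI) (use not_less_Least in blast)
  have "(G * u) $ (i + j) = (\<Sum>k=0..i+j. G $ k * u $ (i + j - k))"
    by (simp add: fps_mult_nth)
  also have "\<dots> = G $ i * u $ j + (\<Sum>k\<in>{0..i+j} - {i}. G $ k * u $ (i + j - k))"
    by (subst sum.remove[of _ i]) auto
  finally have eq: "(G * u) $ (i + j) = \<dots>" .
  have "p dvd (\<Sum>k\<in>{0..i+j} - {i}. G $ k * u $ (i + j - k))"
  proof (rule dvd_sum)
    fix k assume k: "k \<in> {0..i+j} - {i}"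
    show "p dvd G $ k * u $ (i + j - k)"
    proof (cases "k < i")
      case True
      then show ?thesis using i(2) by simp
    next
      case False
      then have "i + j - k < j" using k by auto
      then show ?thesis using j(2) by simp
    qed
  qed
  then have "p dvd G $ i * u $ j"
    using dvd[of "i + j"] unfolding eq by (metis dvd_add_left_iff)
  then show False using p i(1) j(1) by (simp add: prime_elem_dvd_mult_iff)
qed

text \<open>The prime factors of \<open>r\<close> cannot divide \<open>G\<close>, so each of them divides the cofactor \<open>u\<close> and can be
  cancelled.  What remains is a factorization of a unit.\<close>

lemma primitive_fps_dvd_const:
  fixes G u :: "'a::idom fps"
  assumes "prime_count k r" and "fps_const r = G * u"
    and "\<And>p. prime_elem p \<Longrightarrow> \<exists>k. \<not> p dvd G $ k"
  shows "G $ 0 dvd 1"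
  using assms
proof (induction arbitrary: u rule: prime_count.induct)
  case (unit v)
  then have "v = G $ 0 * u $ 0" using fps_mult_nth_0[of G u] unfolding unit(2)[symmetric] by simp
  then show ?case using unit(1) by (metis dvd_mult_left)
next
  case (step p k r)
  have "p dvd (G * u) $ k" for k unfolding step.prems(1)[symmetric] by simp
  then have "\<forall>k. p dvd u $ k"
    using prime_const_dvd_fps_mult[OF step.hyps(1)] step.prems(2)[OF step.hyps(1)] by blast
  then obtain w where w: "\<And>k. u $ k = p * w k" unfolding dvd_def by metis
  have u: "u = fps_const p * Abs_fps w" by (rule fps_ext) (simp add: w)
  have "fps_const p * fps_const r = fps_const p * (G * Abs_fps w)"
    using step.prems(1) by (simp add: u mult_ac)
  then have "fps_const r = G * Abs_fps w"
    using step.hyps(1) by (metis fps_const_nonzero_eq_nonzero mult_left_cancel prime_elem_not_zeroI prime_elem_def)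
  from step.IH[OF this step.prems(2)] show ?case .
qed

section \<open>Annihilators of families of one-dimensional sequences\<close>

text \<open>The embedding of \<open>R[X]\<close> into the Laurent series in \<open>X\<^sup>-\<^sup>1\<close>.  The library's series variable plays the role
  of \<open>X\<^sup>-\<^sup>1\<close>, so \<open>X\<close> itself becomes \<^const>\<open>fls_X_inv\<close>.\<close>

definition inv_series :: "'a::idom poly \<Rightarrow> 'a fls" where
  "inv_series q = poly (map_poly fls_const q) fls_X_inv"

lemma inv_series_0 [simp]: "inv_series 0 = 0"
  by (simp add: inv_series_def)

lemma inv_series_pCons: "inv_series (pCons c q) = fls_const c + fls_X_inv * inv_series q"
  by (simp add: inv_series_def map_poly_pCons)

lemma inv_series_const: "inv_series [:c:] = fls_const c"
  by (simp add: inv_series_pCons)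

lemma inv_series_add: "inv_series (p + q) = inv_series p + inv_series q"
  by (induction p q rule: poly_induct2) (simp_all add: inv_series_pCons algebra_simps flip: fls_plus_const)

lemma inv_series_smult: "inv_series (smult c q) = fls_const c * inv_series q"
  by (induction q) (simp_all add: inv_series_pCons algebra_simps flip: fls_const_mult_const)

lemma inv_series_mult: "inv_series (p * q) = inv_series p * inv_series q"
  by (induction p) (simp_all add: inv_series_pCons inv_series_add inv_series_smult algebra_simps)

lemma inv_series_diff: "inv_series (p - q) = inv_series p - inv_series q"
  using inv_series_add[of "p - q" q] by simp

lemma inv_series_nth: "inv_series q $$ k = (if k \<le> 0 then coeff q (nat (- k)) else 0)"
proof (induction q arbitrary: k)
  case (pCons c q)
  have *: "k < 0 \<Longrightarrow> nat (- k) = Suc (nat (- (k + 1)))" by simp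
  show ?case
    by (auto simp: inv_series_pCons fls_X_inv_times_conv_shift pCons.IH * simp del: nat_minus_as_int)
qed simp

lemma inv_series_eq_0_iff [simp]: "inv_series q = 0 \<longleftrightarrow> q = 0"
proof
  assume "inv_series q = 0"
  then have "coeff q k = 0" for k
    using inv_series_nth[of q "- int k"] by simp
  then show "q = 0" by (simp add: poly_eq_iff)
qed simp

lemma inv_series_mult_nth:
  "(inv_series h * S) $$ k = (\<Sum>a\<le>degree h. coeff h a * S $$ (k + int a))"
proof (induction h arbitrary: k)
  case (pCons c h)
  show ?case
  proof (cases "h = 0")
    case True
    then show ?thesis by (simp add: inv_series_pCons)
  next
    case False
    have "inv_series (pCons c h) * S = fls_const c * S + fls_X_inv * (inv_series h * S)"
      by (simp only: inv_series_pCons distrib_right mult.assoc)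
    then have "(inv_series (pCons c h) * S) $$ k = c * S $$ k + (inv_series h * S) $$ (k + 1)"
      by (simp add: fls_X_inv_times_conv_shift)
    also have "\<dots> = (\<Sum>a\<le>Suc (degree h). coeff (pCons c h) a * S $$ (k + int a))"
      by (subst sum.atMost_Suc_shift) (simp add: pCons.IH add.assoc)
    finally show ?thesis using False by simp
  qed
qed simp

text \<open>The value \<open>t k\<close> is the entry with index \<open>-k\<close> of a sequence on the non-positive integers.\<close>

definition annihilates :: "'a::idom poly \<Rightarrow> (nat \<Rightarrow> 'a) \<Rightarrow> bool" where
  "annihilates h t \<longleftrightarrow> (\<forall>k. (\<Sum>a\<le>degree h. coeff h a * t (k + a)) = 0)"

abbreviation gen_fls :: "(nat \<Rightarrow> 'a::idom) \<Rightarrow> 'a fls" where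
  "gen_fls t \<equiv> fps_to_fls (Abs_fps t)"

text \<open>The coefficients of the product at the non-positive powers of \<open>X\<close> are the entries of the shifted
  sequence.  If they vanish, only finitely many positive powers of \<open>X\<close> remain.\<close>

lemma annihilates_iff:
  "annihilates h t \<longleftrightarrow> (\<exists>\<beta>. inv_series h * gen_fls t = fls_X_inv * inv_series \<beta>)"
proof
  let ?y = "inv_series h * gen_fls t"
  assume ann: "annihilates h t"
  have nonneg: "?y $$ k = 0" if "k \<ge> 0" for k
  proof -
    have "?y $$ k = (\<Sum>a\<le>degree h. coeff h a * t (nat k + a))"
      using that by (auto simp: inv_series_mult_nth nat_add_distrib intro!: sum.cong)
    then show ?thesis using ann by (simp add: annihilates_def)
  qed
  have small: "?y $$ k = 0" if "k < - int (degree h)" for k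
    using that by (auto simp: inv_series_mult_nth intro!: sum.neutral)
  define \<beta> where "\<beta> = (\<Sum>a\<le>degree h. monom (?y $$ (- 1 - int a)) a)"
  have coeff_\<beta>: "coeff \<beta> a = ?y $$ (- 1 - int a)" for a
    using small[of "- 1 - int a"] by (auto simp: \<beta>_def coeff_sum coeff_monom)
  have "?y = fls_X_inv * inv_series \<beta>"
  proof (rule fls_eqI)
    fix k
    show "?y $$ k = (fls_X_inv * inv_series \<beta>) $$ k"
      using nonneg[of k] by (auto simp: fls_X_inv_times_conv_shift inv_series_nth coeff_\<beta>)
  qed
  then show "\<exists>\<beta>. ?y = fls_X_inv * inv_series \<beta>" by blast
next
  assume "\<exists>\<beta>. inv_series h * gen_fls t = fls_X_inv * inv_series \<beta>"
  then obtain \<beta> where \<beta>: "inv_series h * gen_fls t = fls_X_inv * inv_series \<beta>" by blast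
  have "(\<Sum>a\<le>degree h. coeff h a * t (k + a)) = 0" for k
  proof -
    have "(\<Sum>a\<le>degree h. coeff h a * t (k + a)) = (inv_series h * gen_fls t) $$ int k"
      by (auto simp: inv_series_mult_nth nat_add_distrib intro!: sum.cong)
    also have "\<dots> = 0" unfolding \<beta> by (simp add: fls_X_inv_times_conv_shift inv_series_nth)
    finally show ?thesis .
  qed
  then show "annihilates h t" by (simp add: annihilates_def)
qed

lemma annihilates_diff: "annihilates g t \<Longrightarrow> annihilates h t \<Longrightarrow> annihilates (g - h) t"
  unfolding annihilates_iff inv_series_diff by (metis inv_series_diff left_diff_distrib right_diff_distrib)

lemma annihilates_mult: "annihilates h t \<Longrightarrow> annihilates (q * h) t"
  unfolding annihilates_iff inv_series_mult by (metis inv_series_mult mult.assoc mult.left_commute)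

lemma annihilates_smult_cancel: "annihilates (smult c h) t \<Longrightarrow> c \<noteq> 0 \<Longrightarrow> annihilates h t"
  by (auto simp: annihilates_def mult.assoc simp flip: sum_distrib_left)

text \<open>Pseudo-division by an element of least degree leaves a remainder in the ideal, which has to vanish.\<close>

lemma min_degree_pseudo_dvd:
  fixes J :: "'a::idom poly set"
  assumes "\<And>p q. p \<in> J \<Longrightarrow> q \<in> J \<Longrightarrow> p - q \<in> J"
    and "\<And>p q. p \<in> J \<Longrightarrow> q * p \<in> J"
    and "g \<in> J" "g \<noteq> 0" "\<And>q. q \<in> J \<Longrightarrow> q \<noteq> 0 \<Longrightarrow> degree g \<le> degree q" and "h \<in> J"
  shows "\<exists>q. smult (lead_coeff g ^ (Suc (degree h) - degree g)) h = g * q"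
proof -
  let ?a = "lead_coeff g ^ (Suc (degree h) - degree g)"
  obtain q r where qr: "pseudo_divmod h g = (q, r)" by fastforce
  have eq: "smult ?a h = g * q + r" and r: "r = 0 \<or> degree r < degree g"
    using pseudo_divmod[OF \<open>g \<noteq> 0\<close> qr] by auto
  have "r = [:?a:] * h - q * g" using eq by (simp add: mult.commute)
  then have "r \<in> J" using assms by metis
  then have "r = 0" using r assms(5) by fastforce
  then show ?thesis using eq by auto
qed

text \<open>This is a form of Fatou's lemma on power series with coefficients in \<open>R\<close> that are rational over its
  quotient field: the reduced denominator can be chosen with a unit as leading coefficient.\<close>

theorem annihilator_monic_generator:
  fixes T :: "(nat \<Rightarrow> 'a::idom) set"
  assumes ufd: "\<And>r::'a. r \<noteq> 0 \<Longrightarrow> \<exists>k. prime_count k r"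
    and f: "f \<noteq> 0" "\<And>t. t \<in> T \<Longrightarrow> annihilates f t"
  shows "\<exists>g. lead_coeff g = 1 \<and> (\<forall>h. (\<forall>t\<in>T. annihilates h t) \<longleftrightarrow> g dvd h)"
proof -
  define I where "I = {h. \<forall>t\<in>T. annihilates h t}"
  have I_diff: "p - q \<in> I" if "p \<in> I" "q \<in> I" for p q
    using that by (auto simp: I_def intro: annihilates_diff)
  have I_mult: "q * p \<in> I" if "p \<in> I" for p q
    using that annihilates_mult by (auto simp: I_def)
  have I_cancel: "p \<in> I" if "smult c p \<in> I" "c \<noteq> 0" for c p
    using that annihilates_smult_cancel by (auto simp: I_def)
  define D where "D = (LEAST D. \<exists>g\<in>I. g \<noteq> 0 \<and> degree g = D)"
  have ex: "\<exists>g\<in>I. g \<noteq> 0 \<and> degree g = D"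
    unfolding D_def by (rule LeastI[of _ "degree f"]) (use f in \<open>auto simp: I_def\<close>)
  have D_min: "D \<le> degree q" if "q \<in> I" "q \<noteq> 0" for q
    unfolding D_def using that by (auto intro: Least_le)
  define k where "k = (LEAST k. \<exists>g\<in>I. g \<noteq> 0 \<and> degree g = D \<and> prime_count k (lead_coeff g))"
  have "\<exists>k. \<exists>g\<in>I. g \<noteq> 0 \<and> degree g = D \<and> prime_count k (lead_coeff g)"
    using ex ufd by (metis leading_coeff_0_iff)
  then have "\<exists>g\<in>I. g \<noteq> 0 \<and> degree g = D \<and> prime_count k (lead_coeff g)"
    unfolding k_def by (rule LeastI_ex)
  then obtain g where g: "g \<in> I" "g \<noteq> 0" "degree g = D" "prime_count k (lead_coeff g)" by blast
  have k_min: "k \<le> k'" if "q \<in> I" "q \<noteq> 0" "degree q = D" "prime_count k' (lead_coeff q)" for q k'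
    unfolding k_def using that by (auto intro: Least_le)
  have primitive: "\<exists>j. \<not> p dvd coeff g j" if p: "prime_elem p" for p
  proof (rule ccontr)
    assume "\<not> ?thesis"
    then have "[:p:] dvd g" by (simp add: const_poly_dvd_iff)
    then obtain g1 where g1: "g = smult p g1" by auto
    have "p \<noteq> 0" using p by auto
    then have "g1 \<in> I" "g1 \<noteq> 0" "degree g1 = D" using g g1 I_cancel by auto
    moreover have "lead_coeff g = p * lead_coeff g1" using g1 by simp
    then obtain k' where "k' < k" "prime_count k' (lead_coeff g1)"
      using prime_count_cancel_prime[OF g(4) p] by blast
    ultimately show False using k_min by fastforce
  qed
  \<comment> \<open>the multiples of \<open>g\<close> among the Laurent series that are polynomials\<close>
  define J where "J = {q. inv_series g dvd inv_series q}"
  have J_diff: "p - q \<in> J" if "p \<in> J" "q \<in> J" for p q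
    using that by (simp add: J_def inv_series_diff)
  have J_mult: "q * p \<in> J" if "p \<in> J" for p q
    using that by (simp add: J_def inv_series_mult)
  have "g \<in> J" by (simp add: J_def)
  then obtain q where q: "q \<in> J" "q \<noteq> 0" "\<And>p. p \<in> J \<Longrightarrow> p \<noteq> 0 \<Longrightarrow> degree q \<le> degree p"
    using ex_has_least_nat[of "\<lambda>q. q \<in> J \<and> q \<noteq> 0" g degree] g(2) by blast
  have J_dvd: "\<exists>a z. a \<noteq> 0 \<and> smult a p = q * z" if "p \<in> J" for p
    using min_degree_pseudo_dvd[OF J_diff J_mult q that] q(2) by (metis leading_coeff_0_iff power_not_zero)
  obtain a e where e: "a \<noteq> 0" "smult a g = q * e" using J_dvd[OF \<open>g \<in> J\<close>] by blast
  have e0: "e \<noteq> 0" using e g(2) by auto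
  \<comment> \<open>up to constants \<open>e \<cdot> \<Gamma> = X\<beta>/q\<close>, a polynomial multiple of \<open>X\<close> since \<open>q\<close> divides \<open>\<beta>\<close>\<close>
  have "e \<in> I" unfolding I_def
  proof safe
    fix t assume t: "t \<in> T"
    let ?S = "gen_fls t"
    obtain \<beta> where \<beta>: "inv_series g * ?S = fls_X_inv * inv_series \<beta>"
      using g(1) t annihilates_iff unfolding I_def by blast
    have "inv_series \<beta> = inv_series g * (fls_X * ?S)"
    proof -
      have "inv_series g * (fls_X * ?S) = fls_X * (inv_series g * ?S)" by (simp add: mult_ac)
      also have "\<dots> = (fls_X * fls_X_inv) * inv_series \<beta>" unfolding \<beta> by (simp add: mult_ac)
      also have "fls_X * fls_X_inv = (1 :: 'a fls)" by (simp add: fls_X_times_conv_shift)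
      finally show ?thesis by simp
    qed
    then have "\<beta> \<in> J" by (simp add: J_def)
    then obtain b z where z: "b \<noteq> 0" "smult b \<beta> = q * z" using J_dvd by blast
    have "inv_series q * (inv_series (smult b e) * ?S) = fls_const b * (inv_series (q * e) * ?S)"
      by (simp add: inv_series_mult inv_series_smult mult_ac)
    also have "\<dots> = fls_const (b * a) * (inv_series g * ?S)"
      unfolding e(2)[symmetric] by (simp add: inv_series_smult mult_ac flip: fls_const_mult_const)
    also have "\<dots> = fls_const a * fls_X_inv * inv_series (smult b \<beta>)"
      unfolding \<beta> by (simp add: inv_series_smult mult_ac flip: fls_const_mult_const)
    also have "\<dots> = inv_series q * (fls_X_inv * inv_series (smult a z))"
      unfolding z(2) by (simp add: inv_series_mult inv_series_smult mult_ac)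
    finally have "inv_series (smult b e) * ?S = fls_X_inv * inv_series (smult a z)"
      using q(2) by (metis inv_series_eq_0_iff mult_left_cancel)
    then have "annihilates (smult b e) t" using annihilates_iff by blast
    then show "annihilates e t" using z(1) annihilates_smult_cancel by blast
  qed
  then have "D \<le> degree e" using D_min e0 by blast
  moreover have "D = degree q + degree e"
    using e g(3) q(2) e0 by (metis degree_mult_eq degree_smult_eq)
  ultimately have "degree q = 0" by simp
  then obtain r where r: "q = [:r:]" by (rule degree_eq_zeroE)
  have r0: "r \<noteq> 0" using r q(2) by auto
  obtain u where u: "fls_const r = inv_series g * u"
    using q(1) by (auto simp: J_def r inv_series_const)
  \<comment> \<open>the reversed polynomial \<open>g\<close>, whose constant coefficient is the leading coefficient of \<open>g\<close>\<close>
  define G where "G = Abs_fps (\<lambda>j. if j \<le> D then coeff g (D - j) else 0)"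
  have G: "fps_to_fls G = fls_X ^ D * inv_series g"
  proof (rule fls_eqI)
    fix j
    have "coeff g (nat (int D - j)) = 0" if "j < 0"
      using that g(3) by (intro coeff_eq_0) simp
    then show "fps_to_fls G $$ j = (fls_X ^ D * inv_series g) $$ j"
      by (auto simp: G_def fls_X_power_times_conv_shift inv_series_nth nat_diff_distrib')
  qed
  define w where "w = fls_X_inv ^ D * u"
  have XX: "fls_X ^ D * fls_X_inv ^ D = (1 :: 'a fls)"
    by (simp add: fls_X_times_conv_shift flip: power_mult_distrib)
  have eq: "fls_const r = fps_to_fls G * w"
  proof -
    have "fps_to_fls G * w = (fls_X ^ D * fls_X_inv ^ D) * (inv_series g * u)"
      unfolding G w_def by (simp only: mult_ac)
    then show ?thesis using XX u by simp
  qed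
  have G0: "G $ 0 = lead_coeff g" using g(3) by (simp add: G_def)
  have "w \<noteq> 0" "fps_to_fls G \<noteq> 0" using eq r0 by auto
  then have "fls_subdegree (fls_const r) = fls_subdegree (fps_to_fls G) + fls_subdegree w"
    unfolding eq by (rule fls_subdegree_mult[OF _ _, rotated])
  moreover have "subdegree G = 0" using G0 g(2) by simp
  ultimately have "fls_subdegree w \<ge> 0" by (simp add: fls_subdegree_fls_to_fps)
  then have "w = fps_to_fls (fls_regpart w)" by (simp add: fls_regpart_to_fls_trivial)
  then have "fps_to_fls (fps_const r) = fps_to_fls (G * fls_regpart w)"
    using eq by (simp add: fls_times_fps_to_fls)
  then have "fps_const r = G * fls_regpart w" by (simp only: fps_to_fls_eq_iff)
  moreover have "\<exists>j. \<not> p dvd G $ j" if pr: "prime_elem p" for p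
  proof -
    obtain j where j: "\<not> p dvd coeff g j" using primitive[OF pr] by blast
    then have "j \<le> D" using g(3) by (metis coeff_eq_0 dvd_0_right not_le)
    then have "G $ (D - j) = coeff g j" by (simp add: G_def)
    then show ?thesis using j by metis
  qed
  ultimately have "G $ 0 dvd 1" using primitive_fps_dvd_const ufd[OF r0] by blast
  then obtain v where v: "lead_coeff g * v = 1" using G0 by (metis dvdE)
  then have v0: "v \<noteq> 0" by (metis mult_zero_right zero_neq_one)
  \<comment> \<open>a monic generator is \<open>g\<close> divided by its leading coefficient\<close>
  define g' where "g' = smult v g"
  have lc: "lead_coeff g' = 1" using v v0 by (simp add: g'_def mult.commute)
  have g': "g' \<in> I" "g' \<noteq> 0" "degree g' = D"
    using g I_mult[OF g(1), of "[:v:]"] v0 by (auto simp: g'_def)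
  have "h \<in> I \<longleftrightarrow> g' dvd h" for h
  proof
    assume "h \<in> I"
    then have "\<exists>q. smult (lead_coeff g' ^ (Suc (degree h) - degree g')) h = g' * q"
      using min_degree_pseudo_dvd[OF I_diff I_mult g'(1,2)] D_min g'(3) by blast
    then show "g' dvd h" unfolding lc by auto
  next
    assume "g' dvd h"
    then show "h \<in> I" using I_mult[OF g'(1)] by (auto simp: mult.commute)
  qed
  then show ?thesis using lc by (auto simp: I_def)
qed

section \<open>The action of polynomials on formal sums\<close>

abbreviation axis :: "nat \<Rightarrow> int \<Rightarrow> nat \<Rightarrow> int" where
  "axis i k \<equiv> (\<lambda>j. if j = i then k else 0)"

lemma carrier_laurent_iff:
  "F \<in> carrier (laurent_ring n) \<longleftrightarrow> supp F \<subseteq> exponents n \<and> (\<exists>d. \<forall>a\<in>supp F. a \<le> d)"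
  by (simp add: laurent_ring_def)

lemma finite_exponents_bounded_above:
  assumes "finite A"
  shows "\<exists>d. \<forall>a\<in>A. a \<le> (d :: nat \<Rightarrow> int)"
proof (intro exI ballI)
  fix a assume "a \<in> A"
  then show "a \<le> (\<lambda>j. Max ((\<lambda>a. a j) ` A))"
    using assms by (auto simp: le_fun_def)
qed

lemma carrier_mpoly_iff:
  "F \<in> carrier (mpoly_ring n) \<longleftrightarrow>
     supp F \<subseteq> exponents n \<and> finite (supp F) \<and> (\<forall>a\<in>supp F. 0 \<le> a)"
  using finite_exponents_bounded_above[of "supp F"]
  by (auto simp: mpoly_ring_def carrier_laurent_iff)

lemma mpoly_in_laurent: "F \<in> carrier (mpoly_ring n) \<Longrightarrow> F \<in> carrier (laurent_ring n)"
  by (simp add: mpoly_ring_def)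

lemma carrier_univ_iff:
  "F \<in> carrier (univ_poly_ring n i) \<longleftrightarrow>
     F \<in> carrier (mpoly_ring n) \<and> (\<forall>a\<in>supp F. \<forall>j. j \<noteq> i \<longrightarrow> a j = 0)"
  by (simp add: univ_poly_ring_def)

lemma shift_superset:
  assumes "finite A" "supp f \<subseteq> A"
  shows "shift f G b = (\<Sum>a\<in>A. f a * G (b - a))"
  unfolding shift_def using assms by (intro sum.mono_neutral_left) (auto simp: supp_def)

text \<open>For a polynomial as left factor, the product of Laurent series makes sense for an arbitrary formal
  sum as right factor.  So multiplication, right shifting of sequences and the passage to \<open>\<Gamma>(s)\<close> are
  all instances of \<^const>\<open>shift\<close>.\<close>

lemma laurent_mult_eq_shift:
  assumes "finite (supp F)"
  shows "F \<otimes>\<^bsub>laurent_ring n\<^esub> G = shift F G"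
proof
  fix c
  show "(F \<otimes>\<^bsub>laurent_ring n\<^esub> G) c = shift F G c"
    unfolding laurent_ring_def shift_def
    by (simp, rule sum.mono_neutral_left) (use assms in \<open>auto simp: supp_def\<close>)
qed

lemma mpoly_mult_eq_shift:
  assumes "F \<in> carrier (mpoly_ring n)"
  shows "F \<otimes>\<^bsub>mpoly_ring n\<^esub> G = shift F G"
proof -
  have "F \<otimes>\<^bsub>mpoly_ring n\<^esub> G = F \<otimes>\<^bsub>laurent_ring n\<^esub> G" by (simp add: mpoly_ring_def)
  then show ?thesis using assms laurent_mult_eq_shift by (metis carrier_mpoly_iff)
qed

lemma supp_shift:
  assumes "c \<in> supp (shift f G)"
  obtains a b where "a \<in> supp f" "b \<in> supp G" "c = a + b"
proof -
  have "(\<Sum>a\<in>supp f. f a * G (c - a)) \<noteq> 0" using assms by (simp add: supp_def shift_def)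
  then obtain a where "a \<in> supp f" "f a * G (c - a) \<noteq> 0" by (meson sum.neutral)
  then show ?thesis using that[of a "c - a"] by (auto simp: supp_def)
qed

lemma finite_supp_shift:
  assumes "finite (supp f)" "finite (supp g)"
  shows "finite (supp (shift f g))"
proof (rule finite_subset)
  show "supp (shift f g) \<subseteq> (\<lambda>(a, b). a + b) ` (supp f \<times> supp g)"
    by (auto elim!: supp_shift)
qed (use assms in simp)

lemma shift_assoc:
  assumes f: "finite (supp f)" and g: "finite (supp g)"
  shows "shift (shift f g) G = shift f (shift g G)"
proof
  fix c
  let ?P = "(\<lambda>(a, b). a + b) ` (supp f \<times> supp g)"
  have fin: "finite ?P" using assms by simp
  have inner: "(\<Sum>e\<in>?P. g (e - a) * G (c - e)) = shift g G (c - a)" if a: "a \<in> supp f" for a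
  proof -
    have "(\<Sum>e\<in>?P. g (e - a) * G (c - e)) = (\<Sum>b\<in>(\<lambda>e. e - a) ` ?P. g b * G (c - a - b))"
      by (subst sum.reindex) (auto simp: inj_on_def algebra_simps)
    also have "\<dots> = shift g G (c - a)"
    proof (rule shift_superset[symmetric])
      show "finite ((\<lambda>e. e - a) ` ?P)" using fin by simp
      show "supp g \<subseteq> (\<lambda>e. e - a) ` ?P"
      proof
        fix b assume "b \<in> supp g"
        then have "a + b \<in> ?P" using a by force
        then have "(a + b) - a \<in> (\<lambda>e. e - a) ` ?P" by (rule imageI)
        then show "b \<in> (\<lambda>e. e - a) ` ?P" by simp
      qed
    qed
    finally show ?thesis .
  qed
  have "shift (shift f g) G c = (\<Sum>e\<in>?P. shift f g e * G (c - e))"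
    by (rule shift_superset[OF fin]) (auto elim!: supp_shift)
  also have "\<dots> = (\<Sum>e\<in>?P. \<Sum>a\<in>supp f. f a * (g (e - a) * G (c - e)))"
    by (simp add: shift_def sum_distrib_right mult.assoc)
  also have "\<dots> = (\<Sum>a\<in>supp f. f a * (\<Sum>e\<in>?P. g (e - a) * G (c - e)))"
    by (subst sum.swap) (simp add: sum_distrib_left)
  also have "\<dots> = shift f (shift g G) c"
    by (simp add: inner shift_def[of f])
  finally show "shift (shift f g) G c = shift f (shift g G) c" .
qed

lemma shift_commute:
  assumes f: "finite (supp f)" and g: "finite (supp g)"
  shows "shift f g = shift g f"
proof
  fix c
  let ?B = "(\<lambda>a. c - a) ` supp f \<union> supp g"
  let ?A = "(\<lambda>b. c - b) ` ?B"
  have "shift f g c = (\<Sum>a\<in>?A. f a * g (c - a))"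
    by (rule shift_superset) (use f g in \<open>auto simp: image_Un image_image\<close>)
  also have "\<dots> = (\<Sum>b\<in>?B. g b * f (c - b))"
    by (subst sum.reindex) (auto simp: inj_on_def mult.commute)
  also have "\<dots> = shift g f c"
    by (rule shift_superset[symmetric]) (use f g in auto)
  finally show "shift f g c = shift g f c" .
qed

lemma shift_one: "shift (\<lambda>a. if a = 0 then 1 else 0) G = G"
proof
  fix c
  show "shift (\<lambda>a. if a = 0 then 1 else 0) G c = G c"
    by (subst shift_superset[of "{0}"]) (auto simp: supp_def)
qed

lemma exponents_add: "a \<in> exponents n \<Longrightarrow> b \<in> exponents n \<Longrightarrow> a + b \<in> exponents n"
  by (auto simp: exponents_def)

lemma shift_in_mpoly:
  assumes "f \<in> carrier (mpoly_ring n)" "g \<in> carrier (mpoly_ring n)"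
  shows "shift f g \<in> carrier (mpoly_ring n)"
proof -
  have "a \<in> exponents n \<and> 0 \<le> a" if "a \<in> supp (shift f g)" for a
    using that assms by (elim supp_shift) (auto simp: carrier_mpoly_iff intro!: exponents_add)
  then show ?thesis using assms finite_supp_shift by (auto simp: carrier_mpoly_iff)
qed

lemma shift_in_laurent:
  assumes "f \<in> carrier (mpoly_ring n)" "G \<in> carrier (laurent_ring n)"
  shows "shift f G \<in> carrier (laurent_ring n)"
proof -
  obtain d e where d: "\<forall>a\<in>supp f. a \<le> d" and e: "\<forall>a\<in>supp G. a \<le> e"
    using mpoly_in_laurent[OF assms(1)] assms(2) by (auto simp: carrier_laurent_iff)
  have "c \<in> exponents n \<and> c \<le> d + e" if c: "c \<in> supp (shift f G)" for c
  proof -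
    obtain a b where ab: "a \<in> supp f" "b \<in> supp G" "c = a + b" using c by (rule supp_shift)
    then have "a \<le> d" "b \<le> e" using d e by auto
    then have "a + b \<le> d + e" unfolding le_fun_def by (auto intro: add_mono)
    then show ?thesis
      using ab assms by (auto simp: carrier_mpoly_iff carrier_laurent_iff intro!: exponents_add)
  qed
  then show ?thesis unfolding carrier_laurent_iff by blast
qed

lemma comm_monoid_mpoly: "comm_monoid (mpoly_ring n :: ((nat \<Rightarrow> int) \<Rightarrow> 'a::idom) ring)"
proof (rule comm_monoidI)
  let ?P = "mpoly_ring n :: ((nat \<Rightarrow> int) \<Rightarrow> 'a) ring"
  have fin: "finite (supp F)" if "F \<in> carrier ?P" for F using that by (simp add: carrier_mpoly_iff)
  have one: "\<one>\<^bsub>?P\<^esub> = (\<lambda>a. if a = 0 then 1 else 0)"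
    by (simp add: mpoly_ring_def laurent_ring_def)
  show one_closed: "\<one>\<^bsub>?P\<^esub> \<in> carrier ?P"
    unfolding one by (auto simp: carrier_mpoly_iff supp_def exponents_def)
  show "F \<otimes>\<^bsub>?P\<^esub> G \<in> carrier ?P" if "F \<in> carrier ?P" "G \<in> carrier ?P" for F G
    using that mpoly_mult_eq_shift shift_in_mpoly by metis
  show "F \<otimes>\<^bsub>?P\<^esub> G \<otimes>\<^bsub>?P\<^esub> K = F \<otimes>\<^bsub>?P\<^esub> (G \<otimes>\<^bsub>?P\<^esub> K)"
    if "F \<in> carrier ?P" "G \<in> carrier ?P" "K \<in> carrier ?P" for F G K
  proof -
    have "F \<otimes>\<^bsub>?P\<^esub> G = shift F G" "G \<otimes>\<^bsub>?P\<^esub> K = shift G K" "shift F G \<in> carrier ?P"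
      using that mpoly_mult_eq_shift shift_in_mpoly by blast+
    then show ?thesis
      using that mpoly_mult_eq_shift shift_assoc[OF fin fin] by metis
  qed
  show "\<one>\<^bsub>?P\<^esub> \<otimes>\<^bsub>?P\<^esub> F = F" if "F \<in> carrier ?P" for F
    using mpoly_mult_eq_shift[OF one_closed] by (simp add: one shift_one)
  show "F \<otimes>\<^bsub>?P\<^esub> G = G \<otimes>\<^bsub>?P\<^esub> F" if "F \<in> carrier ?P" "G \<in> carrier ?P" for F G
    using that shift_commute[OF fin fin] mpoly_mult_eq_shift by metis
qed

section \<open>Absence of zero divisors\<close>

lemma ex_max_coordinate:
  fixes A :: "(nat \<Rightarrow> int) set"
  assumes "A \<noteq> {}" "\<forall>a\<in>A. a \<le> d"
  shows "\<exists>a\<in>A. \<forall>a'\<in>A. a' j \<le> a j"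
proof -
  obtain a0 where a0: "a0 \<in> A" using assms(1) by blast
  define a where "a = arg_min (\<lambda>a. nat (d j - a j)) (\<lambda>a. a \<in> A)"
  have a: "is_arg_min (\<lambda>a. nat (d j - a j)) (\<lambda>a. a \<in> A) a"
    unfolding a_def by (rule is_arg_min_arg_min_nat[of "\<lambda>a. a \<in> A", OF a0])
  have "a' j \<le> a j" if "a' \<in> A" for a'
  proof -
    have "a \<in> A" using a by (simp add: is_arg_min_def)
    then have "a j \<le> d j" "a' j \<le> d j" using assms(2) that by (auto simp: le_fun_def)
    moreover have "\<not> nat (d j - a' j) < nat (d j - a j)" using a that by (simp add: is_arg_min_def)
    ultimately show ?thesis by linarith
  qed
  then show ?thesis using a by (auto simp: is_arg_min_def)
qed

text \<open>Exponents that are maximal in the lexicographic order given by \<open>js\<close> have a sum that no other pair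
  attains.  Such maxima exist since the sets are bounded above, even if they are infinite.\<close>

lemma unique_sum_of_exponents:
  fixes A B :: "(nat \<Rightarrow> int) set"
  assumes "A \<noteq> {}" "B \<noteq> {}" "\<forall>a\<in>A. a \<le> d" "\<forall>b\<in>B. b \<le> e"
    and "inj_on (\<lambda>a. map a js) A" "inj_on (\<lambda>b. map b js) B"
  shows "\<exists>a\<in>A. \<exists>b\<in>B. (\<forall>a'\<in>A. \<forall>b'\<in>B. a' + b' = a + b \<longrightarrow> a' = a \<and> b' = b) \<and>
     (js \<noteq> [] \<longrightarrow> (\<forall>a'\<in>A. a' (hd js) \<le> a (hd js)) \<and> (\<forall>b'\<in>B. b' (hd js) \<le> b (hd js)))"
  using assms
proof (induction js arbitrary: A B)
  case Nil
  obtain a b where ab: "a \<in> A" "b \<in> B" using Nil(1,2) by auto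
  have "a' = a" if "a' \<in> A" for a'
    by (rule inj_onD[OF Nil(5) _ that ab(1)]) simp
  moreover have "b' = b" if "b' \<in> B" for b'
    by (rule inj_onD[OF Nil(6) _ that ab(2)]) simp
  ultimately have uniq: "\<forall>a'\<in>A. \<forall>b'\<in>B. a' + b' = a + b \<longrightarrow> a' = a \<and> b' = b" by blast
  show ?case
  proof (rule bexI[of _ a], rule bexI[of _ b], rule conjI)
    show "\<forall>a'\<in>A. \<forall>b'\<in>B. a' + b' = a + b \<longrightarrow> a' = a \<and> b' = b" by (fact uniq)
  qed (use ab in simp_all)
next
  case (Cons j js)
  define A' where "A' = {a \<in> A. \<forall>a'\<in>A. a' j \<le> a j}"
  define B' where "B' = {b \<in> B. \<forall>b'\<in>B. b' j \<le> b j}"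
  have ne: "A' \<noteq> {}" "B' \<noteq> {}"
    using ex_max_coordinate[OF Cons(2,4), of j] ex_max_coordinate[OF Cons(3,5), of j]
    unfolding A'_def B'_def by blast+
  have bd: "\<forall>a\<in>A'. a \<le> d" "\<forall>b\<in>B'. b \<le> e"
    using Cons(4,5) unfolding A'_def B'_def by blast+
  have "inj_on (\<lambda>a. map a js) A'"
  proof (rule inj_onI)
    fix a a' assume a: "a \<in> A'" "a' \<in> A'" "map a js = map a' js"
    then have "a \<in> A" "a' \<in> A" "a j = a' j" unfolding A'_def by (auto intro: antisym)
    then show "a = a'" using inj_onD[OF Cons(6), of a a'] a(3) by simp
  qed
  moreover have "inj_on (\<lambda>b. map b js) B'"
  proof (rule inj_onI)
    fix b b' assume b: "b \<in> B'" "b' \<in> B'" "map b js = map b' js"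
    then have "b \<in> B" "b' \<in> B" "b j = b' j" unfolding B'_def by (auto intro: antisym)
    then show "b = b'" using inj_onD[OF Cons(7), of b b'] b(3) by simp
  qed
  ultimately obtain a b where ab: "a \<in> A'" "b \<in> B'"
    and uniq: "\<forall>a'\<in>A'. \<forall>b'\<in>B'. a' + b' = a + b \<longrightarrow> a' = a \<and> b' = b"
    using Cons.IH[OF ne bd] by blast
  have abm: "a \<in> A" "b \<in> B" and max: "\<forall>a'\<in>A. a' j \<le> a j" "\<forall>b'\<in>B. b' j \<le> b j"
    using ab unfolding A'_def B'_def by blast+
  have uniq_AB: "a' = a \<and> b' = b" if ab': "a' \<in> A" "b' \<in> B" "a' + b' = a + b" for a' b'
  proof -
    have "a' j + b' j = a j + b j" using fun_cong[OF ab'(3), of j] by simp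
    moreover have "a' j \<le> a j" "b' j \<le> b j" using max ab' by blast+
    ultimately have "a' j = a j" "b' j = b j" by linarith+
    then have "a' \<in> A'" "b' \<in> B'" using ab'(1,2) max unfolding A'_def B'_def by auto
    then show ?thesis using uniq ab'(3) by blast
  qed
  show ?case
  proof (rule bexI[of _ a], rule bexI[of _ b], rule conjI)
    show "\<forall>a'\<in>A. \<forall>b'\<in>B. a' + b' = a + b \<longrightarrow> a' = a \<and> b' = b" using uniq_AB by blast
  qed (use abm max in simp_all)
qed

text \<open>The coefficient at the sum of the lexicographically largest exponents is the product of two
  non-zero coefficients.  The variable \<open>X\<^sub>j\<close> may be given the highest priority.\<close>

lemma shift_top_exponent:
  assumes f: "f \<in> carrier (mpoly_ring n)" "f \<noteq> 0" and G: "G \<in> carrier (laurent_ring n)" "G \<noteq> 0"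
  obtains a b where "a \<in> supp f" "b \<in> supp G" "a + b \<in> supp (shift f G)"
    "\<And>a'. a' \<in> supp f \<Longrightarrow> a' j \<le> a j" "\<And>b'. b' \<in> supp G \<Longrightarrow> b' j \<le> b j"
proof -
  have ne: "supp f \<noteq> {}" "supp G \<noteq> {}" using f(2) G(2) by (auto simp: supp_def fun_eq_iff)
  obtain d e where bd: "\<forall>a\<in>supp f. a \<le> d" "\<forall>a\<in>supp G. a \<le> e"
    using mpoly_in_laurent[OF f(1)] G(1) by (auto simp: carrier_laurent_iff)
  let ?js = "j # [1..<Suc n]"
  have "inj_on (\<lambda>a. map a ?js) (exponents n)"
  proof (rule inj_onI)
    fix a a' assume a: "a \<in> exponents n" "a' \<in> exponents n" "map a ?js = map a' ?js"
    then have eq: "\<forall>k\<in>set ?js. a k = a' k" by (simp only: map_eq_conv)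
    show "a = a'"
    proof
      fix k show "a k = a' k"
      proof (cases "k \<in> {1..n}")
        case True
        then show ?thesis using eq by (auto simp del: upt_Suc)
      qed (use a in \<open>simp add: exponents_def\<close>)
    qed
  qed
  moreover have "supp f \<subseteq> exponents n" "supp G \<subseteq> exponents n"
    using f G by (auto simp: carrier_mpoly_iff carrier_laurent_iff)
  ultimately have inj: "inj_on (\<lambda>a. map a ?js) (supp f)" "inj_on (\<lambda>a. map a ?js) (supp G)"
    using inj_on_subset by blast+
  obtain a b where ab: "a \<in> supp f" "b \<in> supp G"
    and uniq: "\<forall>a'\<in>supp f. \<forall>b'\<in>supp G. a' + b' = a + b \<longrightarrow> a' = a \<and> b' = b"
    and max: "\<forall>a'\<in>supp f. a' j \<le> a j" "\<forall>b'\<in>supp G. b' j \<le> b j"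
    using unique_sum_of_exponents[OF ne bd inj] unfolding list.sel by blast
  have fin: "finite (supp f)" using f by (simp add: carrier_mpoly_iff)
  have "shift f G (a + b) = (\<Sum>a'\<in>supp f. if a' = a then f a * G b else 0)"
    unfolding shift_def
  proof (rule sum.cong)
    fix a' assume a': "a' \<in> supp f"
    show "f a' * G (a + b - a') = (if a' = a then f a * G b else 0)"
    proof (cases "a' = a")
      case False
      have "a' + (a + b - a') = a + b" by simp
      then have "a + b - a' \<notin> supp G" using uniq a' False by blast
      then show ?thesis using False by (simp add: supp_def)
    qed simp
  qed simp
  also have "\<dots> = f a * G b" using fin ab(1) by simp
  finally have "a + b \<in> supp (shift f G)" using ab by (simp add: supp_def)
  then show ?thesis using that[OF ab] max by blast
qed

lemma shift_0_left [simp]: "shift 0 G = 0"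
  by (rule ext) (simp add: shift_def)

lemma shift_0_right [simp]: "shift f 0 = 0"
  by (rule ext) (simp add: shift_def)

lemma shift_diff_right: "shift f (G - K) = shift f G - shift f K"
  by (rule ext) (simp add: shift_def algebra_simps sum_subtractf)

lemma shift_eq_0D:
  assumes "f \<in> carrier (mpoly_ring n)" "f \<noteq> 0" "G \<in> carrier (laurent_ring n)" "shift f G = 0"
  shows "G = 0"
proof (rule ccontr)
  assume "G \<noteq> 0"
  then obtain a b where "a + b \<in> supp (shift f G)"
    using shift_top_exponent[OF assms(1,2,3)] by metis
  then show False using assms(4) by (simp add: supp_def)
qed

lemma shift_cancel:
  assumes "f \<in> carrier (mpoly_ring n)" "f \<noteq> 0" "G \<in> carrier (laurent_ring n)"
    "K \<in> carrier (laurent_ring n)" "shift f G = shift f K"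
  shows "G = K"
proof -
  obtain d e where "\<forall>a\<in>supp G. a \<le> d" "\<forall>a\<in>supp K. a \<le> e"
    using assms by (auto simp: carrier_laurent_iff)
  then have "\<forall>a\<in>supp (G - K). a \<le> sup d e"
    by (auto simp: supp_def) (metis le_supI1 le_supI2 diff_0_right)
  moreover have "supp (G - K) \<subseteq> supp G \<union> supp K" by (auto simp: supp_def)
  ultimately have "G - K \<in> carrier (laurent_ring n)"
    using assms unfolding carrier_laurent_iff by blast
  then have "G - K = 0" using shift_eq_0D assms by (metis shift_diff_right right_minus_eq)
  then show ?thesis by simp
qed

lemma exact_quot_mpoly:
  assumes "b \<in> carrier (mpoly_ring n)" "b \<noteq> 0" "c \<in> carrier (mpoly_ring n)" "a = shift b c"
  shows "exact_quot (mpoly_ring n) a b = c"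
  unfolding exact_quot_def
proof (rule the_equality)
  show "c \<in> carrier (mpoly_ring n) \<and> a = b \<otimes>\<^bsub>mpoly_ring n\<^esub> c"
    using assms by (simp add: mpoly_mult_eq_shift)
  fix c' assume "c' \<in> carrier (mpoly_ring n) \<and> a = b \<otimes>\<^bsub>mpoly_ring n\<^esub> c'"
  then show "c' = c"
    using assms shift_cancel[OF assms(1,2)] by (auto simp: mpoly_mult_eq_shift mpoly_in_laurent)
qed

text \<open>Give \<open>X\<^sub>j\<close> with \<open>j \<noteq> i\<close> the highest priority in \<open>shift_top_exponent\<close>: the degrees in \<open>X\<^sub>j\<close> add up, and
  that of the product is 0.\<close>

lemma univ_poly_factors:
  assumes f: "f \<in> carrier (mpoly_ring n)" and g: "g \<in> carrier (mpoly_ring n)"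
    and fg: "shift f g \<in> carrier (univ_poly_ring n i)" "shift f g \<noteq> 0"
  shows "f \<in> carrier (univ_poly_ring n i) \<and> g \<in> carrier (univ_poly_ring n i)"
proof -
  have f0: "f \<noteq> 0" and g0: "g \<noteq> 0" using fg(2) by auto
  have "(\<forall>a\<in>supp f. a j = 0) \<and> (\<forall>a\<in>supp g. a j = 0)" if "j \<noteq> i" for j
  proof -
    obtain a b where ab: "a \<in> supp f" "b \<in> supp g" "a + b \<in> supp (shift f g)"
      "\<And>a'. a' \<in> supp f \<Longrightarrow> a' j \<le> a j" "\<And>b'. b' \<in> supp g \<Longrightarrow> b' j \<le> b j"
      using shift_top_exponent[OF f f0 mpoly_in_laurent[OF g] g0, of j] by blast
    have "a j + b j = 0" using fg(1) ab(3) \<open>j \<noteq> i\<close> by (auto simp: carrier_univ_iff)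
    moreover have nn: "0 \<le> a' j" if "a' \<in> supp f \<or> a' \<in> supp g" for a'
      using that f g by (auto simp: carrier_mpoly_iff le_fun_def)
    ultimately have "a j = 0" "b j = 0" using ab(1,2) by (smt (verit))+
    then show ?thesis using ab(4,5) nn by (metis order_antisym)
  qed
  then show ?thesis using f g by (auto simp: carrier_univ_iff)
qed

section \<open>Polynomials in one of the variables\<close>

definition univ_emb :: "nat \<Rightarrow> 'a::idom poly \<Rightarrow> (nat \<Rightarrow> int) \<Rightarrow> 'a" where
  "univ_emb i q = (\<lambda>a. if (\<forall>j. j \<noteq> i \<longrightarrow> a j = 0) \<and> 0 \<le> a i then coeff q (nat (a i)) else 0)"

lemma univ_emb_axis: "univ_emb i q (axis i (int k)) = coeff q k"
  by (simp add: univ_emb_def)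

lemma univ_emb_inject: "univ_emb i p = univ_emb i q \<longleftrightarrow> p = q"
  by (metis poly_eqI univ_emb_axis)

lemma axis_form: "(\<forall>j. j \<noteq> i \<longrightarrow> a j = 0) \<Longrightarrow> 0 \<le> a i \<Longrightarrow> a = axis i (int (nat (a i)))"
  by auto

lemma supp_univ_emb: "supp (univ_emb i q) \<subseteq> (\<lambda>k. axis i (int k)) ` {..degree q}"
proof
  fix a assume "a \<in> supp (univ_emb i q)"
  then have a: "\<forall>j. j \<noteq> i \<longrightarrow> a j = 0" "0 \<le> a i" "coeff q (nat (a i)) \<noteq> 0"
    by (auto simp: supp_def univ_emb_def split: if_splits)
  then show "a \<in> (\<lambda>k. axis i (int k)) ` {..degree q}"
    using axis_form[OF a(1,2)] le_degree[OF a(3)] by blast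
qed

lemma shift_univ_emb:
  "shift (univ_emb i q) G b = (\<Sum>k\<le>degree q. coeff q k * G (b - axis i (int k)))"
proof -
  have inj: "inj_on (\<lambda>k. axis i (int k)) {..degree q}"
    by (auto simp: inj_on_def fun_eq_iff split: if_splits)
  show ?thesis
    by (subst shift_superset[OF _ supp_univ_emb]) (simp_all add: sum.reindex[OF inj] univ_emb_axis)
qed

lemma univ_emb_in_univ: "i \<in> {1..n} \<Longrightarrow> univ_emb i q \<in> carrier (univ_poly_ring n i)"
proof -
  assume i: "i \<in> {1..n}"
  have "\<exists>k. a = axis i (int k)" if "a \<in> supp (univ_emb i q)" for a
    using that supp_univ_emb[of i q] by blast
  then have "a \<in> exponents n \<and> 0 \<le> a \<and> (\<forall>j. j \<noteq> i \<longrightarrow> a j = 0)"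
    if "a \<in> supp (univ_emb i q)" for a
    using that i by (fastforce simp: exponents_def le_fun_def)
  moreover have "finite (supp (univ_emb i q))"
    using finite_subset[OF supp_univ_emb[of i q]] by simp
  ultimately show ?thesis unfolding carrier_univ_iff carrier_mpoly_iff by blast
qed

lemma univ_poly_eq_emb:
  assumes "F \<in> carrier (univ_poly_ring n i)"
  obtains q where "F = univ_emb i q"
proof -
  have fin: "finite (supp F)" and nn: "\<forall>a\<in>supp F. 0 \<le> a"
    and ax: "\<forall>a\<in>supp F. \<forall>j. j \<noteq> i \<longrightarrow> a j = 0"
    using assms by (auto simp: carrier_univ_iff carrier_mpoly_iff)
  have "{k. F (axis i (int k)) \<noteq> 0} \<subseteq> (\<lambda>a. nat (a i)) ` supp F"
  proof
    fix k assume "k \<in> {k. F (axis i (int k)) \<noteq> 0}"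
    then have "axis i (int k) \<in> supp F" by (simp add: supp_def)
    then show "k \<in> (\<lambda>a. nat (a i)) ` supp F" by (rule rev_image_eqI) simp
  qed
  then have "finite {k. F (axis i (int k)) \<noteq> 0}" using fin finite_surj by blast
  then obtain N where N: "\<And>k. F (axis i (int k)) \<noteq> 0 \<Longrightarrow> k \<le> N"
    unfolding finite_nat_set_iff_bounded_le by blast
  define q where "q = Abs_poly (\<lambda>k. F (axis i (int k)))"
  have q: "coeff q k = F (axis i (int k))" for k
    unfolding q_def by (subst coeff_Abs_poly[of N]) (use N in force)+
  have "F = univ_emb i q"
  proof
    fix a
    show "F a = univ_emb i q a"
    proof (cases "(\<forall>j. j \<noteq> i \<longrightarrow> a j = 0) \<and> 0 \<le> a i")
      case True
      then show ?thesis using axis_form[of i a] q[of "nat (a i)"] by (simp add: univ_emb_def)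
    next
      case False
      then have "a \<notin> supp F" using nn ax by (auto simp: le_fun_def)
      then show ?thesis using False by (auto simp: univ_emb_def supp_def)
    qed
  qed
  then show ?thesis by (rule that)
qed

lemma univ_emb_mult: "shift (univ_emb i p) (univ_emb i q) = univ_emb i (p * q)"
proof
  fix b :: "nat \<Rightarrow> int"
  let ?on = "(\<forall>j. j \<noteq> i \<longrightarrow> b j = 0) \<and> 0 \<le> b i"
  show "shift (univ_emb i p) (univ_emb i q) b = univ_emb i (p * q) b"
  proof (cases ?on)
    case True
    define m where "m = nat (b i)"
    have b: "b = axis i (int m)" using True axis_form unfolding m_def by blast
    have val: "univ_emb i q (b - axis i (int k)) = (if k \<le> m then coeff q (m - k) else 0)" for k
      by (auto simp: b univ_emb_def nat_diff_distrib')
    have "shift (univ_emb i p) (univ_emb i q) b =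
        (\<Sum>k\<le>degree p. coeff p k * (if k \<le> m then coeff q (m - k) else 0))"
      by (simp add: shift_univ_emb val)
    also have "\<dots> = (\<Sum>k\<le>max m (degree p). coeff p k * (if k \<le> m then coeff q (m - k) else 0))"
      by (rule sum.mono_neutral_left) (auto simp: coeff_eq_0)
    also have "\<dots> = (\<Sum>k\<le>m. coeff p k * coeff q (m - k))"
      by (rule sum.mono_neutral_cong_right) auto
    also have "\<dots> = coeff (p * q) m" by (simp add: coeff_mult)
    finally show ?thesis by (simp add: b univ_emb_axis)
  next
    case False
    have "univ_emb i q (b - axis i (int k)) = 0" for k
      using False by (auto simp: univ_emb_def)
    then have "shift (univ_emb i p) (univ_emb i q) b = 0" by (simp add: shift_univ_emb)
    moreover have "univ_emb i (p * q) b = 0" unfolding univ_emb_def using False by auto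
    ultimately show ?thesis by simp
  qed
qed

lemma degree_univ_emb:
  assumes "q \<noteq> 0"
  shows "partial_degree (univ_emb i q) i = int (degree q)"
  unfolding partial_degree_def
proof (rule Max_eqI)
  show "finite (insert 0 ((\<lambda>a. a i) ` supp (univ_emb i q)))"
    using finite_subset[OF supp_univ_emb[of i q]] by simp
  show "y \<le> int (degree q)" if "y \<in> insert 0 ((\<lambda>a. a i) ` supp (univ_emb i q))" for y
    using that supp_univ_emb[of i q] by fastforce
  have "axis i (int (degree q)) \<in> supp (univ_emb i q)"
    using assms by (simp add: supp_def univ_emb_axis)
  then have "axis i (int (degree q)) i \<in> (\<lambda>a. a i) ` supp (univ_emb i q)" by (rule imageI)
  then show "int (degree q) \<in> insert 0 ((\<lambda>a. a i) ` supp (univ_emb i q))" by simp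
qed

lemma indet_eq_univ_emb: "indet i = univ_emb i [:0, 1:]"
proof
  fix a
  show "indet i a = (univ_emb i [:0, 1:] a :: 'a)"
  proof (cases "a = axis i 1")
    case True
    then show ?thesis using univ_emb_axis[of i "[:0, 1:]" 1] by (simp add: indet_def cong: if_cong)
  next
    case False
    have "univ_emb i [:0, 1:] a = (0 :: 'a)"
    proof (rule ccontr)
      assume nz: "univ_emb i [:0, 1:] a \<noteq> (0 :: 'a)"
      then have "a \<in> supp (univ_emb i [:0, 1 :: 'a:])" by (simp add: supp_def)
      then obtain k where k: "a = axis i (int k)" using supp_univ_emb by blast
      then have "coeff [:0, 1 :: 'a:] k \<noteq> 0" using nz by (simp only: univ_emb_axis not_False_eq_True)
      then have "k = 1" by (auto simp: coeff_pCons split: nat.splits)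
      then show False using k False by (simp cong: if_cong)
    qed
    then show ?thesis using False by (simp add: indet_def)
  qed
qed

lemma shift_indet: "shift (indet i) G b = G (b - axis i 1)"
  by (simp add: indet_eq_univ_emb shift_univ_emb cong: if_cong)

lemma univ_emb_0 [simp]: "univ_emb i 0 = 0"
  by (auto simp: univ_emb_def fun_eq_iff)

lemma univ_emb_eq_0_iff: "univ_emb i q = 0 \<longleftrightarrow> q = 0"
  using univ_emb_inject[of i q 0] by simp

section \<open>Annihilators and the exponents of the generating series\<close>

lemma neg_exponents_iff:
  "b \<in> neg_exponents n \<longleftrightarrow> (\<forall>j. b j \<le> 0 \<and> (j \<notin> {1..n} \<longrightarrow> b j = 0))"
  by (auto simp: neg_exponents_def exponents_def le_fun_def)

lemma shift_gen_series:
  assumes h: "h \<in> carrier (mpoly_ring n)" and b: "b \<in> neg_exponents n"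
  shows "shift h (gen_series n s) b = shift h s b"
  unfolding shift_def
proof (rule sum.cong)
  fix a assume "a \<in> supp h"
  then have a: "a \<in> exponents n" "0 \<le> a" using h by (auto simp: carrier_mpoly_iff)
  have "b - a \<in> neg_exponents n"
    unfolding neg_exponents_iff
  proof (intro allI conjI impI)
    fix j
    have "b j \<le> 0" "0 \<le> a j" using a(2) b by (auto simp: neg_exponents_iff le_fun_def)
    then show "(b - a) j \<le> 0" by simp
    assume "j \<notin> {1..n}"
    then show "(b - a) j = 0" using a(1) b by (simp add: neg_exponents_iff exponents_def)
  qed
  then show "h a * gen_series n s (b - a) = h a * s (b - a)" by (simp add: gen_series_def)
qed simp

lemma gen_series_laurent: "gen_series n s \<in> carrier (laurent_ring n)"
  by (auto simp: carrier_laurent_iff supp_def gen_series_def neg_exponents_def split: if_splits)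

text \<open>In \<open>h \<cdot> \<Gamma>(s)\<close> all components of an exponent other than the i-th are non-positive, as \<open>h\<close> only involves
  \<open>X\<^sub>i\<close>.  So an exponent lies in the range where \<open>h \<circ> s\<close> lives iff its i-th component is non-positive.\<close>

lemma univ_Ann_iff:
  assumes h: "h \<in> carrier (univ_poly_ring n i)" and i: "i \<in> {1..n}"
  shows "h \<in> Ann n s \<longleftrightarrow> (\<forall>c\<in>supp (shift h (gen_series n s)). 1 \<le> c i)"
proof -
  have hm: "h \<in> carrier (mpoly_ring n)" using h by (simp add: carrier_univ_iff)
  have Ann: "h \<in> Ann n s \<longleftrightarrow> (\<forall>b\<in>neg_exponents n. shift h (gen_series n s) b = 0)"
    using hm shift_gen_series[OF hm] by (auto simp: Ann_def)
  have neg: "c \<in> neg_exponents n" if c: "c \<in> supp (shift h (gen_series n s))" and "c i \<le> 0" for c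
  proof -
    obtain a b where ab: "a \<in> supp h" "b \<in> supp (gen_series n s)" "c = a + b"
      using c by (rule supp_shift)
    have b: "b \<in> neg_exponents n" using ab(2) by (auto simp: supp_def gen_series_def split: if_splits)
    have a: "\<forall>j. j \<noteq> i \<longrightarrow> a j = 0" using h ab(1) by (simp add: carrier_univ_iff)
    have "c j \<le> 0" for j
      using a b \<open>c i \<le> 0\<close> ab(3) by (cases "j = i") (auto simp: neg_exponents_iff)
    moreover have "c j = 0" if "j \<notin> {1..n}" for j
      using that a b ab(3) i by (cases "j = i") (auto simp: neg_exponents_iff)
    ultimately show ?thesis by (simp add: neg_exponents_iff)
  qed
  show ?thesis
  proof
    assume "h \<in> Ann n s"
    then show "\<forall>c\<in>supp (shift h (gen_series n s)). 1 \<le> c i"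
      unfolding Ann using neg by (metis (mono_tags, lifting) int_one_le_iff_zero_less linorder_not_less mem_Collect_eq supp_def)
  next
    assume *: "\<forall>c\<in>supp (shift h (gen_series n s)). 1 \<le> c i"
    have "shift h (gen_series n s) b = 0" if "b \<in> neg_exponents n" for b
    proof -
      have "b i \<le> 0" using that by (simp add: neg_exponents_iff)
      then have "b \<notin> supp (shift h (gen_series n s))" using * by fastforce
      then show ?thesis by (simp add: supp_def)
    qed
    then show "h \<in> Ann n s" unfolding Ann by blast
  qed
qed

text \<open>The one-dimensional sequences obtained by restricting \<open>s\<close> to the half-lines parallel to the i-th
  axis.\<close>

definition axis_slices :: "nat \<Rightarrow> nat \<Rightarrow> ((nat \<Rightarrow> int) \<Rightarrow> 'a) \<Rightarrow> (nat \<Rightarrow> 'a) set" where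
  "axis_slices n i s = (\<lambda>b k. s (b - axis i (int k))) ` neg_exponents n"

lemma univ_emb_Ann_iff:
  assumes i: "i \<in> {1..n}"
  shows "univ_emb i h \<in> Ann n s \<longleftrightarrow> (\<forall>t\<in>axis_slices n i s. annihilates h t)"
proof -
  have mem: "univ_emb i h \<in> carrier (mpoly_ring n)"
    using univ_emb_in_univ[OF i, of h] by (simp add: carrier_univ_iff)
  have add: "b - axis i (int k) - axis i (int a) = b - axis i (int (k + a))" for b k a
    by auto
  have sh: "shift (univ_emb i h) s (b - axis i (int k)) =
      (\<Sum>a\<le>degree h. coeff h a * s (b - axis i (int (k + a))))" for b k
    unfolding shift_univ_emb add ..
  have neg: "b - axis i (int k) \<in> neg_exponents n" if "b \<in> neg_exponents n" for b k
  proof -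
    have "b i \<le> 0" using that by (simp add: neg_exponents_iff)
    then show ?thesis using that i unfolding neg_exponents_iff by (auto intro: order_trans[of _ 0])
  qed
  show ?thesis
  proof
    assume ann: "univ_emb i h \<in> Ann n s"
    show "\<forall>t\<in>axis_slices n i s. annihilates h t"
      using ann neg sh unfolding Ann_def axis_slices_def annihilates_def by fastforce
  next
    assume ann: "\<forall>t\<in>axis_slices n i s. annihilates h t"
    have "shift (univ_emb i h) s b = 0" if "b \<in> neg_exponents n" for b
    proof -
      have "b - axis i (int 0) = b" by (auto simp: fun_eq_iff)
      then have "shift (univ_emb i h) s b = (\<Sum>a\<le>degree h. coeff h a * s (b - axis i (int (0 + a))))"
        using sh[of b 0] by simp
      moreover have "annihilates h (\<lambda>k. s (b - axis i (int k)))"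
        using ann that unfolding axis_slices_def by blast
      ultimately show ?thesis unfolding annihilates_def by metis
    qed
    then show "univ_emb i h \<in> Ann n s" using mem by (simp add: Ann_def)
  qed
qed

section \<open>Products of annihilators and the border polynomial\<close>

lemma finprod_mpoly:
  assumes "finite A" "\<And>k. k \<in> A \<Longrightarrow> v k \<in> carrier (mpoly_ring n)"
  shows "finprod (mpoly_ring n) v A \<in> carrier (mpoly_ring n)"
    and "(\<And>k. k \<in> A \<Longrightarrow> \<forall>a\<in>supp (v k). a j = 0) \<Longrightarrow> \<forall>a\<in>supp (finprod (mpoly_ring n) v A). a j = 0"
    and "(\<And>k. k \<in> A \<Longrightarrow> v k \<noteq> (0 :: _ \<Rightarrow> 'a::idom)) \<Longrightarrow> finprod (mpoly_ring n) v A \<noteq> 0"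
proof -
  let ?P = "mpoly_ring n :: ((nat \<Rightarrow> int) \<Rightarrow> 'a) ring"
  interpret P: comm_monoid ?P by (rule comm_monoid_mpoly)
  have one: "\<one>\<^bsub>?P\<^esub> = (\<lambda>a. if a = 0 then 1 else 0)"
    by (simp add: mpoly_ring_def laurent_ring_def)
  have car: "finprod ?P v B \<in> carrier ?P" if "B \<subseteq> A" for B
    using that assms by (intro P.finprod_closed) auto
  then show "finprod ?P v A \<in> carrier ?P" by blast
  have ins: "finprod ?P v (insert k B) = shift (v k) (finprod ?P v B)"
    if "finite B" "k \<notin> B" "insert k B \<subseteq> A" for k B
    using that assms(2) by (subst P.finprod_insert) (auto intro!: mpoly_mult_eq_shift)
  show "\<forall>a\<in>supp (finprod ?P v A). a j = 0" if j: "\<And>k. k \<in> A \<Longrightarrow> \<forall>a\<in>supp (v k). a j = 0"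
  proof -
    have "B \<subseteq> A \<Longrightarrow> \<forall>a\<in>supp (finprod ?P v B). a j = 0" if "finite B" for B
      using that
    proof (induction rule: finite_induct)
      case empty
      then show ?case by (simp add: one supp_def)
    next
      case (insert k B)
      then show ?case using j by (auto simp: ins elim!: supp_shift)
    qed
    then show ?thesis using assms(1) by blast
  qed
  show "finprod ?P v A \<noteq> 0" if nz: "\<And>k. k \<in> A \<Longrightarrow> v k \<noteq> 0"
  proof -
    have "B \<subseteq> A \<Longrightarrow> finprod ?P v B \<noteq> 0" if "finite B" for B
      using that
    proof (induction rule: finite_induct)
      case empty
      then show ?case by (auto simp: one fun_eq_iff)
    next
      case (insert k B)
      then have k: "v k \<in> carrier ?P" "v k \<noteq> 0" and B: "finprod ?P v B \<in> carrier (laurent_ring n)"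
        "finprod ?P v B \<noteq> 0" using assms(2) nz mpoly_in_laurent[OF car[of B]] by blast+
      have "finprod ?P v (insert k B) = shift (v k) (finprod ?P v B)"
        using ins insert by blast
      then show ?case using shift_eq_0D[OF k B(1)] B(2) by metis
    qed
    then show ?thesis using assms(1) by blast
  qed
qed

lemma finprod_mpoly_remove:
  assumes "finite A" "i \<in> A" "\<And>k. k \<in> A \<Longrightarrow> v k \<in> carrier (mpoly_ring n)"
  shows "finprod (mpoly_ring n) v A = shift (v i) (finprod (mpoly_ring n) v (A - {i}))"
proof -
  interpret P: comm_monoid "mpoly_ring n" by (rule comm_monoid_mpoly)
  have "finprod (mpoly_ring n) v (insert i (A - {i})) =
      v i \<otimes>\<^bsub>mpoly_ring n\<^esub> finprod (mpoly_ring n) v (A - {i})"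
    using assms by (subst P.finprod_insert) auto
  then show ?thesis
    using assms(2) mpoly_mult_eq_shift[OF assms(3)[OF assms(2)]] by (simp add: insert_absorb)
qed

definition div_indet :: "nat \<Rightarrow> ((nat \<Rightarrow> int) \<Rightarrow> 'a) \<Rightarrow> (nat \<Rightarrow> int) \<Rightarrow> 'a" where
  "div_indet i G = (\<lambda>a. G (a + axis i 1))"

lemma shift_indet_div: "shift (indet i) (div_indet i G) = (G :: _ \<Rightarrow> 'a::idom)"
proof
  fix b
  have "b - axis i 1 + axis i 1 = b" by (rule diff_add_cancel)
  then show "shift (indet i) (div_indet i G) b = G b" by (simp add: shift_indet div_indet_def)
qed

text \<open>The exponents of \<open>G\<close> lie in a finite box: they are positive in every component and bounded above.\<close>

lemma div_indet_in_mpoly: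
  assumes G: "G \<in> carrier (laurent_ring n)" and i: "i \<in> {1..n}"
    and pos: "\<And>c j. c \<in> supp G \<Longrightarrow> j \<in> {1..n} \<Longrightarrow> 1 \<le> c j"
  shows "div_indet i G \<in> carrier (mpoly_ring n)"
proof -
  obtain d where d: "\<forall>a\<in>supp G. a \<le> d" and ex: "supp G \<subseteq> exponents n"
    using G by (auto simp: carrier_laurent_iff)
  let ?S = "{c. \<forall>j. (j \<in> {1..n} \<longrightarrow> c j \<in> (\<Union>j\<in>{1..n}. {1..d j})) \<and> (j \<notin> {1..n} \<longrightarrow> c j = 0)}"
  have fin: "finite ?S" by (rule finite_set_of_finite_funs) auto
  have "supp G \<subseteq> ?S"
  proof
    fix c assume c: "c \<in> supp G"
    have "c j \<in> {1..d j}" if "j \<in> {1..n}" for j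
      using pos[OF c that] d c by (auto simp: le_fun_def)
    moreover have "c j = 0" if "j \<notin> {1..n}" for j
      using c ex that by (auto simp: exponents_def)
    ultimately show "c \<in> ?S" by blast
  qed
  then have finG: "finite (supp G)" using fin finite_subset by blast
  have sub: "supp (div_indet i G) \<subseteq> (\<lambda>c. c - axis i 1) ` supp G"
  proof
    fix a assume "a \<in> supp (div_indet i G)"
    then have "a + axis i 1 \<in> supp G" by (simp add: supp_def div_indet_def)
    then have "(a + axis i 1) - axis i 1 \<in> (\<lambda>c. c - axis i 1) ` supp G" by (rule imageI)
    then show "a \<in> (\<lambda>c. c - axis i 1) ` supp G" by (simp only: add_diff_cancel_right')
  qed
  have "a \<in> exponents n \<and> 0 \<le> a" if a: "a \<in> supp (div_indet i G)" for a
  proof -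
    obtain c where c: "c \<in> supp G" "a = c - axis i 1" using sub a by blast
    have out: "c j = 0" if "j \<notin> {1..n}" for j using that c ex by (auto simp: exponents_def)
    have "0 \<le> a j" for j
      using out[of j] pos[OF c(1), of j] c(2) i by (cases "j \<in> {1..n}") auto
    moreover have "a j = 0" if "j \<notin> {1..n}" for j using out[OF that] c(2) i that by auto
    ultimately show ?thesis by (simp add: exponents_def le_fun_def)
  qed
  then show ?thesis
    using finite_subset[OF sub] finG by (auto simp: carrier_mpoly_iff)
qed

lemma mpoly_finite: "F \<in> carrier (mpoly_ring n) \<Longrightarrow> finite (supp F)"
  by (simp add: carrier_mpoly_iff)

lemma shift_left_commute:
  assumes "f \<in> carrier (mpoly_ring n)" "g \<in> carrier (mpoly_ring n)"
  shows "shift f (shift g G) = shift g (shift f G)"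
  using assms by (metis mpoly_finite shift_assoc shift_commute)

text \<open>Apply the factor \<open>v j\<close> to \<open>\<Gamma>(s)\<close> first.  This makes the j-th components positive, and the other factors
  leave these components alone.\<close>

lemma finprod_Ann_exponents_pos:
  assumes v: "\<And>k. k \<in> {1..n} \<Longrightarrow> v k \<in> Ann n s \<inter> carrier (univ_poly_ring n k)"
    and c: "c \<in> supp (shift (finprod (mpoly_ring n) v {1..n}) (gen_series n s))" and j: "j \<in> {1..n}"
  shows "1 \<le> c j"
proof -
  let ?W = "finprod (mpoly_ring n) v ({1..n} - {j})"
  have vm: "v k \<in> carrier (mpoly_ring n)" if "k \<in> {1..n}" for k
    using v[OF that] by (simp add: carrier_univ_iff)
  have Wm: "?W \<in> carrier (mpoly_ring n)" by (rule finprod_mpoly(1)) (use vm in auto)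
  have W0: "\<forall>a\<in>supp ?W. a j = 0"
  proof (rule finprod_mpoly(2))
    show "\<forall>a\<in>supp (v k). a j = 0" if "k \<in> {1..n} - {j}" for k
      using v[of k] that by (auto simp: carrier_univ_iff)
  qed (use vm in auto)
  have eq: "shift (finprod (mpoly_ring n) v {1..n}) (gen_series n s) = shift ?W (shift (v j) (gen_series n s))"
    using finprod_mpoly_remove[OF _ j vm] shift_assoc[OF mpoly_finite[OF vm[OF j]] mpoly_finite[OF Wm]]
      shift_left_commute[OF vm[OF j] Wm] by simp
  obtain a b where ab: "a \<in> supp ?W" "b \<in> supp (shift (v j) (gen_series n s))" "c = a + b"
    using c unfolding eq by (rule supp_shift)
  have "1 \<le> b j" using univ_Ann_iff[of "v j" n j] v[OF j] j ab(2) by blast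
  moreover have "a j = 0" using W0 ab(1) by blast
  ultimately show ?thesis using ab(3) by simp
qed

text \<open>The truncation in the definition of the border polynomial cuts nothing off: exponents of \<open>f \<cdot> \<Gamma>(s)\<close>
  are positive, and they do not exceed the degrees of \<open>f\<close> as those of \<open>\<Gamma>(s)\<close> are non-positive.\<close>

lemma border_poly_eq:
  assumes v: "\<And>k. k \<in> {1..n} \<Longrightarrow> v k \<in> Ann n s \<inter> carrier (univ_poly_ring n k)"
  shows "border_poly n (finprod (mpoly_ring n) v {1..n}) s =
    shift (finprod (mpoly_ring n) v {1..n}) (gen_series n s)"
proof
  fix c
  let ?F = "finprod (mpoly_ring n) v {1..n}"
  let ?G = "shift ?F (gen_series n s)"
  have Fm: "?F \<in> carrier (mpoly_ring n)"
    by (rule finprod_mpoly(1)) (use v in \<open>auto simp: carrier_univ_iff\<close>)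
  have "c \<in> exponents n \<and> (\<forall>j\<in>{1..n}. 1 \<le> c j \<and> c j \<le> partial_degree ?F j)" if c: "c \<in> supp ?G"
  proof -
    obtain a b where ab: "a \<in> supp ?F" "b \<in> supp (gen_series n s)" "c = a + b"
      using c by (rule supp_shift)
    have "c j \<le> partial_degree ?F j" for j
    proof -
      have "b j \<le> 0" using ab(2) by (auto simp: supp_def gen_series_def neg_exponents_iff split: if_splits)
      then have "c j \<le> a j" using ab(3) by simp
      moreover have "a j \<le> partial_degree ?F j"
        unfolding partial_degree_def using ab(1) mpoly_finite[OF Fm] by (intro Max_ge) auto
      ultimately show ?thesis by (rule order_trans)
    qed
    moreover have "c \<in> exponents n"
      using shift_in_laurent[OF Fm gen_series_laurent] c by (auto simp: carrier_laurent_iff)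
    ultimately show ?thesis using finprod_Ann_exponents_pos[OF v c] by blast
  qed
  then have "?G c = 0" if "\<not> (c \<in> exponents n \<and> (\<forall>j\<in>{1..n}. 1 \<le> c j \<and> c j \<le> partial_degree ?F j))"
    using that unfolding supp_def by blast
  then show "border_poly n ?F s c = ?G c"
    unfolding border_poly_def laurent_mult_eq_shift[OF mpoly_finite[OF Fm]] by presburger
qed

text \<open>Multiplication by \<open>W\<close> maps the part \<open>Z\<close> of \<open>K\<close> with non-positive i-th components to the
  corresponding part of the product.  That part is zero, and \<open>W\<close> is not a zero divisor.\<close>

lemma shift_cancel_exponents_pos:
  assumes W: "W \<in> carrier (mpoly_ring n)" "W \<noteq> 0" "\<forall>a\<in>supp W. a i = 0"
    and K: "K \<in> carrier (laurent_ring n)" and pos: "\<forall>c\<in>supp (shift W K). 1 \<le> c i"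
  shows "\<forall>c\<in>supp K. 1 \<le> c i"
proof -
  define Z where "Z = (\<lambda>a. if a i \<le> 0 then K a else 0)"
  have "supp Z \<subseteq> supp K" by (auto simp: Z_def supp_def)
  then have Zl: "Z \<in> carrier (laurent_ring n)" using K unfolding carrier_laurent_iff by blast
  have "shift W Z = 0"
  proof
    fix c
    have "shift W Z c = (\<Sum>a\<in>supp W. if c i \<le> 0 then W a * K (c - a) else 0)"
      unfolding shift_def using W(3) by (intro sum.cong) (auto simp: Z_def)
    also have "\<dots> = (if c i \<le> 0 then shift W K c else 0)" by (simp add: shift_def)
    also have "\<dots> = 0"
    proof (cases "c i \<le> 0")
      case True
      then have "c \<notin> supp (shift W K)" using pos by fastforce
      then show ?thesis by (simp add: supp_def)
    qed simp
    finally show "shift W Z c = 0 c" by simp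
  qed
  then have "Z = 0" using shift_eq_0D[OF W(1,2) Zl] by blast
  show ?thesis
  proof
    fix c assume c: "c \<in> supp K"
    show "1 \<le> c i"
    proof (rule ccontr)
      assume "\<not> 1 \<le> c i"
      then have "Z c = K c" by (simp add: Z_def)
      then show False using c \<open>Z = 0\<close> by (simp add: supp_def)
    qed
  qed
qed

lemma univ_emb_scale: "scale u (univ_emb i q) = univ_emb i (smult u q)"
  by (rule ext) (auto simp: scale_def univ_emb_def)

section \<open>Comparison with the greatest common divisor\<close>

theorem theorem4p13:
  fixes n :: nat
    and s :: "(nat \<Rightarrow> int) \<Rightarrow> 'a::idom"
    and f :: "nat \<Rightarrow> (nat \<Rightarrow> int) \<Rightarrow> 'a"
    and F :: "(nat \<Rightarrow> int) \<Rightarrow> 'a"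
    and d :: "nat \<Rightarrow> (nat \<Rightarrow> int) \<Rightarrow> 'a"
  assumes "potential TYPE('a)"
    and "n \<ge> 1"
    and "\<exists>a\<in>neg_exponents n. s a \<noteq> 0"
    and "\<And>i. i \<in> {1..n} \<Longrightarrow> f i \<in> Ann n s \<inter> carrier (univ_poly_ring n i)"
    and "\<And>i. i \<in> {1..n} \<Longrightarrow> partial_degree (f i) i \<ge> 1"
    and "F = finprod (mpoly_ring n) f {1..n}"
    and "\<And>i. i \<in> {1..n} \<Longrightarrow> d i \<in> carrier (mpoly_ring n)"
    and "\<And>i. i \<in> {1..n} \<Longrightarrow>
           (d i) gcdof\<^bsub>mpoly_ring n\<^esub> (f i) (exact_quot (mpoly_ring n) (border_poly n F s) (indet i))"
  shows "\<forall>i\<in>{1..n}. \<exists>u. u dvd 1 \<and>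
           monic_generator n i (exact_quot (mpoly_ring n) (scale u (f i)) (d i))
             (Ann n s \<inter> carrier (univ_poly_ring n i))"
proof
  fix i assume i: "i \<in> {1..n}"
  let ?P = "mpoly_ring n :: ((nat \<Rightarrow> int) \<Rightarrow> 'a) ring"
  let ?U = "univ_poly_ring n i :: ((nat \<Rightarrow> int) \<Rightarrow> 'a) ring"
  let ?G = "gen_series n s"
  have fm: "f k \<in> carrier ?P" if "k \<in> {1..n}" for k
    using assms(4)[OF that] by (simp add: carrier_univ_iff)
  have f0: "f k \<noteq> 0" if "k \<in> {1..n}" for k
    using assms(5)[OF that] by (auto simp: partial_degree_def supp_def)
  have Gl: "?G \<in> carrier (laurent_ring n)" by (rule gen_series_laurent)
  define W where "W = finprod ?P f ({1..n} - {i})"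
  have Wm: "W \<in> carrier ?P" unfolding W_def by (rule finprod_mpoly(1)) (use fm in auto)
  have W0: "W \<noteq> 0" unfolding W_def by (rule finprod_mpoly(3)) (use fm f0 in auto)
  have Wi: "\<forall>a\<in>supp W. a i = 0"
    unfolding W_def
  proof (rule finprod_mpoly(2))
    show "\<forall>a\<in>supp (f k). a i = 0" if "k \<in> {1..n} - {i}" for k
      using assms(4)[of k] that by (auto simp: carrier_univ_iff)
  qed (use fm in auto)
  have F: "F = shift (f i) W"
    unfolding assms(6) W_def by (rule finprod_mpoly_remove) (use i fm in auto)
  have Fm: "F \<in> carrier ?P" using F fm[OF i] Wm shift_in_mpoly by blast
  have border: "border_poly n F s = shift F ?G"
    unfolding assms(6) by (rule border_poly_eq) (fact assms(4))
  define B where "B = div_indet i (shift F ?G)"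
  have Bm: "B \<in> carrier ?P"
    unfolding B_def
  proof (rule div_indet_in_mpoly[OF _ i])
    show "shift F ?G \<in> carrier (laurent_ring n)" using Fm Gl by (rule shift_in_laurent)
    show "1 \<le> c j" if "c \<in> supp (shift F ?G)" "j \<in> {1..n}" for c j
      using finprod_Ann_exponents_pos[OF assms(4)] that unfolding assms(6) by blast
  qed
  have xB: "shift (indet i) B = shift F ?G" unfolding B_def by (rule shift_indet_div)
  have xm: "indet i \<in> carrier ?P" "indet i \<noteq> (0 :: _ \<Rightarrow> 'a)"
    using univ_emb_in_univ[OF i, of "[:0, 1:] :: 'a poly"]
    by (auto simp: indet_eq_univ_emb carrier_univ_iff univ_emb_eq_0_iff)
  have quot: "exact_quot ?P (border_poly n F s) (indet i) = B"
    unfolding border using exact_quot_mpoly[OF xm Bm] xB by simp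

  obtain \<phi> where \<phi>: "f i = univ_emb i \<phi>"
    using assms(4)[OF i] univ_poly_eq_emb by blast
  have \<phi>0: "\<phi> \<noteq> 0" using f0[OF i] \<phi> by auto
  have ufd: "\<exists>k. prime_count k r" if "r \<noteq> 0" for r :: 'a
    by (rule factorial_domain_prime_count[OF _ that]) (use assms(1) in \<open>simp add: potential_def\<close>)
  have \<phi>_ann: "annihilates \<phi> t" if "t \<in> axis_slices n i s" for t
    using univ_emb_Ann_iff[OF i, of \<phi> s] assms(4)[OF i] that unfolding \<phi> by blast
  have "\<exists>\<eta>. lead_coeff \<eta> = 1 \<and> (\<forall>h. (\<forall>t\<in>axis_slices n i s. annihilates h t) \<longleftrightarrow> \<eta> dvd h)"
  proof (rule annihilator_monic_generator)
    show "\<exists>k. prime_count k r" if "r \<noteq> 0" for r :: 'a using ufd[OF that] .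
    show "\<phi> \<noteq> 0" by fact
    show "annihilates \<phi> t" if "t \<in> axis_slices n i s" for t using \<phi>_ann[OF that] .
  qed
  then obtain \<eta> where \<eta>: "lead_coeff \<eta> = 1"
    and ann_dvd: "\<And>h. (\<forall>t\<in>axis_slices n i s. annihilates h t) \<longleftrightarrow> \<eta> dvd h"
    by blast
  have ann: "univ_emb i h \<in> Ann n s \<longleftrightarrow> \<eta> dvd h" for h
    unfolding univ_emb_Ann_iff[OF i] by (rule ann_dvd)
  have "\<eta> dvd \<phi>" using assms(4)[OF i] unfolding \<phi> by (simp add: ann)
  then obtain \<epsilon> where \<epsilon>: "\<phi> = \<eta> * \<epsilon>" by (rule dvdE)
  have embm: "univ_emb i q \<in> carrier ?P" for q
    using univ_emb_in_univ[OF i, of q] by (simp add: carrier_univ_iff)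

  \<comment> \<open>\<open>\<epsilon>\<close> divides \<open>B\<close>: replace the factor \<open>f i = \<eta>\<epsilon>\<close> of \<open>F\<close> by \<open>\<eta>\<close>\<close>
  have "univ_emb i \<epsilon> divides\<^bsub>?P\<^esub> B"
  proof -
    define v where "v = f(i := univ_emb i \<eta>)"
    have v: "v k \<in> Ann n s \<inter> carrier (univ_poly_ring n k)" if "k \<in> {1..n}" for k
      using assms(4)[OF that] ann[of \<eta>] univ_emb_in_univ[OF i] by (auto simp: v_def)
    have vm: "v k \<in> carrier ?P" if "k \<in> {1..n}" for k
      using v[OF that] by (simp add: carrier_univ_iff)
    let ?V = "finprod ?P v {1..n}"
    interpret P: comm_monoid ?P by (rule comm_monoid_mpoly)
    have "finprod ?P v ({1..n} - {i}) = W"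
      unfolding W_def by (rule P.finprod_cong) (use fm in \<open>auto simp: v_def simp_implies_def\<close>)
    then have V: "?V = shift (univ_emb i \<eta>) W"
      using finprod_mpoly_remove[where v = v, OF finite_atLeastAtMost i vm] unfolding v_def by simp
    have Vm: "?V \<in> carrier ?P" by (rule finprod_mpoly(1)) (use vm in auto)
    define Y where "Y = div_indet i (shift ?V ?G)"
    have Ym: "Y \<in> carrier ?P"
      unfolding Y_def
    proof (rule div_indet_in_mpoly[OF _ i])
      show "shift ?V ?G \<in> carrier (laurent_ring n)" using Vm Gl by (rule shift_in_laurent)
      show "1 \<le> c j" if "c \<in> supp (shift ?V ?G)" "j \<in> {1..n}" for c j
        using finprod_Ann_exponents_pos[OF v] that by blast
    qed
    have xY: "shift (indet i) Y = shift ?V ?G" unfolding Y_def by (rule shift_indet_div)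
    have "F = shift (univ_emb i \<epsilon>) ?V"
      unfolding F \<phi> \<epsilon> V
      by (metis embm mpoly_finite mult.commute shift_assoc univ_emb_mult)
    then have "shift (indet i) B = shift (univ_emb i \<epsilon>) (shift ?V ?G)"
      unfolding xB using shift_assoc mpoly_finite embm Vm by metis
    also have "\<dots> = shift (indet i) (shift (univ_emb i \<epsilon>) Y)"
      unfolding xY[symmetric] using shift_left_commute embm xm(1) by blast
    finally have "B = shift (univ_emb i \<epsilon>) Y"
      using shift_cancel[OF xm mpoly_in_laurent[OF Bm] mpoly_in_laurent[OF shift_in_mpoly[OF embm Ym]]]
      by blast
    then show ?thesis using Ym mpoly_mult_eq_shift[OF embm] unfolding factor_def by metis
  qed
  moreover have "univ_emb i \<epsilon> divides\<^bsub>?P\<^esub> f i"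
    unfolding factor_def \<phi> \<epsilon> using mpoly_mult_eq_shift[OF embm] embm[of \<eta>] univ_emb_mult
    by (metis mult.commute)
  moreover note gcd = assms(8)[OF i, unfolded quot isgcd_def]
  ultimately have "univ_emb i \<epsilon> divides\<^bsub>?P\<^esub> d i" using embm by blast
  then obtain w where w: "w \<in> carrier ?P" "d i = shift (univ_emb i \<epsilon>) w"
    unfolding factor_def using mpoly_mult_eq_shift[OF embm] by metis
  obtain c where c: "c \<in> carrier ?P" "f i = shift (d i) c"
    using gcd mpoly_mult_eq_shift[OF assms(7)[OF i]] unfolding factor_def by metis
  obtain b where b: "b \<in> carrier ?P" "B = shift (d i) b"
    using gcd mpoly_mult_eq_shift[OF assms(7)[OF i]] unfolding factor_def by metis
  have dc: "d i \<in> carrier ?U" "c \<in> carrier ?U"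
    using univ_poly_factors[OF assms(7)[OF i] c(1)] assms(4)[OF i] f0[OF i] c(2) by auto
  have d0: "d i \<noteq> 0" using c(2) f0[OF i] by auto
  have "w \<in> carrier ?U"
    using univ_poly_factors[OF embm w(1)] dc(1) d0 w(2) by metis
  then obtain \<omega> where \<omega>: "w = univ_emb i \<omega>" by (rule univ_poly_eq_emb)
  obtain \<gamma> where \<gamma>: "c = univ_emb i \<gamma>" using dc(2) by (rule univ_poly_eq_emb)
  have d\<epsilon>: "d i = univ_emb i (\<epsilon> * \<omega>)" using w(2) \<omega> by (simp add: univ_emb_mult)

  \<comment> \<open>cancel \<open>f i\<close> in \<open>f i \<cdot> W \<cdot> c \<cdot> \<Gamma> = c \<cdot> X\<^sub>i \<cdot> B = f i \<cdot> X\<^sub>i \<cdot> b\<close>, then drop \<open>W\<close>\<close>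
  have "c \<in> Ann n s"
  proof -
    let ?K = "shift c ?G"
    have Kl: "?K \<in> carrier (laurent_ring n)" using c(1) Gl by (rule shift_in_laurent)
    have "shift (f i) (shift W ?K) = shift c (shift F ?G)"
      unfolding F using c(1) Wm fm[OF i]
      by (metis mpoly_finite shift_assoc shift_left_commute)
    also have "\<dots> = shift c (shift (indet i) (shift (d i) b))"
      unfolding xB[symmetric] b(2) ..
    also have "\<dots> = shift (f i) (shift (indet i) b)"
      unfolding c(2) using c(1) assms(7)[OF i] xm(1)
      by (metis mpoly_finite shift_assoc shift_left_commute)
    finally have WK: "shift W ?K = shift (indet i) b"
      using shift_cancel[OF fm[OF i] f0[OF i] shift_in_laurent[OF Wm Kl]
          mpoly_in_laurent[OF shift_in_mpoly[OF xm(1) b(1)]]] by blast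
    have "\<forall>a\<in>supp (shift W ?K). 1 \<le> a i"
    proof
      fix a assume "a \<in> supp (shift W ?K)"
      then have "a - axis i 1 \<in> supp b" unfolding WK by (simp add: supp_def shift_indet)
      then have "0 \<le> a - axis i 1" using b(1) unfolding carrier_mpoly_iff by blast
      from le_funD[OF this, of i] show "1 \<le> a i" by simp
    qed
    then have "\<forall>a\<in>supp ?K. 1 \<le> a i"
      by (rule shift_cancel_exponents_pos[OF Wm W0 Wi Kl])
    then show ?thesis unfolding univ_Ann_iff[OF dc(2) i] .
  qed
  then have "\<eta> dvd \<gamma>" unfolding \<gamma> by (simp add: ann)
  then obtain \<gamma>' where \<gamma>': "\<gamma> = \<eta> * \<gamma>'" by (rule dvdE)
  have "\<phi> = (\<epsilon> * \<omega>) * \<gamma>"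
    using c(2) by (simp only: \<phi> d\<epsilon> \<gamma> univ_emb_mult univ_emb_inject)
  then have "\<phi> = (\<eta> * \<epsilon>) * (\<omega> * \<gamma>')" unfolding \<gamma>' by (simp only: mult_ac)
  then have "\<phi> * (\<omega> * \<gamma>') = \<phi> * 1" by (simp only: \<epsilon>[symmetric] mult_1_right)
  then have unit: "\<omega> * \<gamma>' = 1" using \<phi>0 by (metis mult_left_cancel)
  then have "\<omega> \<noteq> 0" "\<gamma>' \<noteq> 0" by auto
  then have "degree \<omega> + degree \<gamma>' = 0" using unit by (metis degree_1 degree_mult_eq)
  then have "degree \<gamma>' = 0" by simp
  then obtain r where r: "\<gamma>' = [:r:]" by (rule degree_eq_zeroE)
  have "coeff (\<omega> * \<gamma>') 0 = 1" using unit by simp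
  then have ru: "coeff \<omega> 0 * r = 1" by (simp add: r mult.commute)
  \<comment> \<open>the unit by which the monic generator \<open>\<eta>\<close> differs from the quotient \<open>c\<close>\<close>
  define u where "u = coeff \<omega> 0"
  have u: "u * r = 1" using ru by (simp add: u_def)
  have "scale u (f i) = shift (d i) (univ_emb i \<eta>)"
  proof -
    have "smult u \<phi> = smult (u * r) (\<epsilon> * \<omega> * \<eta>)"
      using \<open>\<phi> = (\<epsilon> * \<omega>) * \<gamma>\<close> \<gamma>' r by (simp add: mult.commute)
    then show ?thesis using u by (simp add: \<phi> univ_emb_scale d\<epsilon> univ_emb_mult)
  qed
  then have q: "exact_quot ?P (scale u (f i)) (d i) = univ_emb i \<eta>"
    using exact_quot_mpoly[OF assms(7)[OF i] d0 embm] by blast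
  have \<eta>0: "\<eta> \<noteq> 0" using \<eta> by auto
  have "monic_generator n i (univ_emb i \<eta>) (Ann n s \<inter> carrier ?U)"
    unfolding monic_generator_def
  proof (intro conjI)
    show \<eta>U: "univ_emb i \<eta> \<in> carrier ?U" using i by (rule univ_emb_in_univ)
    show "monic_in i (univ_emb i \<eta>)"
      using \<eta> by (simp add: monic_in_def degree_univ_emb[OF \<eta>0] univ_emb_axis cong: if_cong)
    have U_mult: "univ_emb i p \<otimes>\<^bsub>?U\<^esub> univ_emb i q = univ_emb i (p * q)" for p q
    proof -
      have "univ_emb i p \<otimes>\<^bsub>?U\<^esub> univ_emb i q = univ_emb i p \<otimes>\<^bsub>?P\<^esub> univ_emb i q"
        by (simp add: univ_poly_ring_def)
      then show ?thesis using mpoly_mult_eq_shift[OF embm] univ_emb_mult by metis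
    qed
    show "Ann n s \<inter> carrier ?U = PIdl\<^bsub>?U\<^esub> univ_emb i \<eta>"
    proof (intro equalityI subsetI)
      fix h assume h: "h \<in> Ann n s \<inter> carrier ?U"
      then obtain p where p: "h = univ_emb i p" using univ_poly_eq_emb by blast
      then have "\<eta> dvd p" using h by (simp add: ann)
      then obtain q where "p = q * \<eta>" by (metis dvdE mult.commute)
      then have "h = univ_emb i q \<otimes>\<^bsub>?U\<^esub> univ_emb i \<eta>" using p U_mult by simp
      then show "h \<in> PIdl\<^bsub>?U\<^esub> univ_emb i \<eta>"
        unfolding cgenideal_def using univ_emb_in_univ[OF i] by blast
    next
      fix h assume "h \<in> PIdl\<^bsub>?U\<^esub> univ_emb i \<eta>"
      then obtain x where x: "x \<in> carrier ?U" "h = x \<otimes>\<^bsub>?U\<^esub> univ_emb i \<eta>"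
        unfolding cgenideal_def by blast
      then obtain q where "x = univ_emb i q" using univ_poly_eq_emb by blast
      then have "h = univ_emb i (q * \<eta>)" using x(2) U_mult by simp
      then show "h \<in> Ann n s \<inter> carrier ?U" using ann univ_emb_in_univ[OF i] by simp
    qed
  qed
  then have gen: "monic_generator n i (exact_quot ?P (scale u (f i)) (d i)) (Ann n s \<inter> carrier ?U)"
    unfolding q .
  show "\<exists>u. u dvd 1 \<and>
      monic_generator n i (exact_quot ?P (scale u (f i)) (d i)) (Ann n s \<inter> carrier ?U)"
  proof (intro exI conjI)
    show "u dvd 1" using u by (rule dvdI[OF sym])
  qed (rule gen)
qed

end
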